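(* Let $(G,P)$ be a left-ordered group and $z\in P$ a central element of $G$ with $z>1$. Let $p=p_{[1,z]}$ be the point of $\hat\Delta$ associated to the interval $[1,z]\subset G$, equipped with its cyclic structure $F:\Lambda\to\mathrm{Sets}$, and let $G'=\{g\in G\mid \exists n\in\mathbb N,\ z^{-n}\le g\le z^n\}$. Then: (i) There exists a unique group law on the set $|C|_p$ such that $$(\gamma,g)\cdot(\gamma',\gamma_*g)=(\gamma\gamma',g)\qquad\forall n\ge 0,\ \gamma,\gamma'\in\mathrm{Aut}_\Lambda([n]),\ g\in F(n).$$ (ii) The map $\iota_{[1,z]}:|C|_p\to G'/z^{\mathbb Z}$, which sends the class of $(\tau_n^a,g)$, $0\le a\le n$, to the class of $g_0g_1\cdots g_{a-1}$, is a group isomorphism. (iii) Let $S$ be a cyclic set. There exists a unique right action of the group $|C|_p$ on $|S|_p$ such that $$(x,g)\triangleleft(\gamma,g)=(x\gamma^{-1},\gamma_*g)\qquad\forall n\ge0,\ \gamma\in\mathrm{Aut}_\Lambda([n]),\ x\in S_n,\ g\in F(n).$$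
   Context: A left order on a group $G$ is a subsemigroup $P\subset G$ with $P\cap P^{-1}=\{1\}$ and $P\cup P^{-1}=G$; the associated total order is $a\le b\iff a^{-1}b\in P$. $\Delta$ is the simplicial category: objects $[n]=\{0,\dots,n\}$, $n\ge0$, morphisms the non-decreasing maps. The cyclic category $\Lambda$ has one object $[n]$ for each $n\ge 0$, and $\mathrm{Hom}_\Lambda([n],[m])$ is the set of non-decreasing maps $f:\mathbb Z\to\mathbb Z$ with $f(x+n+1)=f(x)+m+1$ for all $x$, modulo $f\sim f+k(m+1)$, $k\in\mathbb Z$. $\tau_n\in\mathrm{Aut}_\Lambda([n])$ is the class of $x\mapsto x-1$; $\mathrm{Aut}_\Lambda([n])=\{\tau_n^a:0\le a\le n\}$ is cyclic of order $n+1$. $\Delta$ is a subcategory of $\Lambda$ by extending $f\in\mathrm{Hom}_\Delta([n],[m])$ periodically: $f(x+k(n+1))=f(x)+k(m+1)$ for $x\in[n]$, $k\in\mathbb Z$. Every $f\in\mathrm{Hom}_\Lambda([m],[n])$ factors uniquely as $f=h\circ\gamma$ with $h\in\mathrm{Hom}_\Delta([m],[n])$, $\gamma\in\mathrm{Aut}_\Lambda([m])$. A simplicial (resp. cyclic) set is a contravariant functor $S$ from $\Delta$ (resp. $\Lambda$) to Sets; we write $S_n=S([n])$ and $x\varphi\in S_m$ for the right action of $\varphi:[m]\to[n]$ on $x\in S_n$. $C$ is the cyclic set with $C_n=\mathrm{Aut}_\Lambda([n])$, where for $\gamma\in C_n$ and $\varphi\in\mathrm{Hom}_\Lambda([m],[n])$,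 $\gamma\varphi\in C_m$ is the automorphism component of the unique factorization of $\gamma\circ\varphi$. The cyclic structure $F:\Lambda\to\mathrm{Sets}$ on $p$ (written in the coordinates $g_j=\beta_j^{-1}\beta_{j+1}$ for non-decreasing sequences $1=\beta_0\le\beta_1\le\dots\le\beta_{n+1}=z$ in $G$) is: $F(n)=\{(g_0,\dots,g_n): g_i\in P,\ g_0g_1\cdots g_n=z\}$; for $\varphi\in\mathrm{Hom}_\Delta([n],[m])$, $(\varphi_*g)_j$ is the product, in increasing order of $i$, of the $g_i$ with $\varphi(i)=j$ (equal to $1$ if there are none); and $(\tau_n)_*(g_0,\dots,g_n)=(g_1,\dots,g_n,g_0)$. For $\lambda\in\mathrm{Hom}_\Lambda([n],[m])$ write $\lambda_*g=F(\lambda)(g)$. For a cyclic (or simplicial) set $S$, $|S|_p=S\otimes_\Delta F=\big(\coprod_{n\ge0}S_n\times F(n)\big)/\!\sim$, where $\sim$ is the equivalence relation generated by $(x\varphi,g)\sim(x,\varphi_*g)$ for $\varphi\in\mathrm{Hom}_\Delta([m],[n])$, $x\in S_n$, $g\in F(m)$. This is the inverse image $p^*S$ of the underlying simplicial set. Pairs $(x,g)$ in the claim denote their classes. *)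

theory Defs
  imports "HOL-Algebra.Coset"
begin

section \<open>Left-ordered groups\<close>

locale left_ordered_group = group G for G (structure) +
  fixes P :: "'a set"
  assumes pos_subset: "P \<subseteq> carrier G"
    and pos_mult: "\<lbrakk>a \<in> P; b \<in> P\<rbrakk> \<Longrightarrow> a \<otimes> b \<in> P"
    and pos_Int_inv: "P \<inter> set_inv P = {\<one>}"
    and pos_Un_inv: "P \<union> set_inv P = carrier G"

definition lo_le :: "('g, 'b) monoid_scheme \<Rightarrow> 'g set \<Rightarrow> 'g \<Rightarrow> 'g \<Rightarrow> bool" where
  "lo_le G P a b \<longleftrightarrow> inv\<^bsub>G\<^esub> a \<otimes>\<^bsub>G\<^esub> b \<in> P"

definition bounded_part :: "('g, 'b) monoid_scheme \<Rightarrow> 'g set \<Rightarrow> 'g \<Rightarrow> 'g set" where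
  "bounded_part G P z =
     {g \<in> carrier G. \<exists>n::nat. lo_le G P (z [^]\<^bsub>G\<^esub> (- int n)) g \<and> lo_le G P g (z [^]\<^bsub>G\<^esub> n)}"

definition int_powers :: "('g, 'b) monoid_scheme \<Rightarrow> 'g \<Rightarrow> 'g set" where
  "int_powers G z = range (\<lambda>k::int. z [^]\<^bsub>G\<^esub> k)"

definition list_mult :: "('g, 'b) monoid_scheme \<Rightarrow> 'g list \<Rightarrow> 'g" where
  "list_mult G gs = foldr (\<otimes>\<^bsub>G\<^esub>) gs \<one>\<^bsub>G\<^esub>"


section \<open>The simplicial and the cyclic category\<close>

text \<open>Objects are represented by natural numbers, with \<open>n\<close> standing for \<open>[n] = {0,\<dots>,n}\<close>.\<close>

definition Delta_hom :: "nat \<Rightarrow> nat \<Rightarrow> (nat \<Rightarrow> nat) set" where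
  "Delta_hom n m = {f \<in> {..n} \<rightarrow>\<^sub>E {..m}. mono_on {..n} f}"

definition Delta_id :: "nat \<Rightarrow> nat \<Rightarrow> nat" where
  "Delta_id n = restrict id {..n}"

text \<open>\<open>Delta_comp n f g\<close> is the composite of \<open>g\<close>, with source \<open>[n]\<close>, followed by \<open>f\<close>.\<close>

definition Delta_comp :: "nat \<Rightarrow> (nat \<Rightarrow> nat) \<Rightarrow> (nat \<Rightarrow> nat) \<Rightarrow> nat \<Rightarrow> nat" where
  "Delta_comp n f g = compose {..n} f g"

definition periodic_maps :: "nat \<Rightarrow> nat \<Rightarrow> (int \<Rightarrow> int) set" where
  "periodic_maps n m = {f. mono f \<and> (\<forall>x. f (x + int n + 1) = f x + int m + 1)}"

definition shift_class :: "nat \<Rightarrow> (int \<Rightarrow> int) \<Rightarrow> (int \<Rightarrow> int) set" where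
  "shift_class m f = range (\<lambda>k x. f x + k * (int m + 1))"

definition Lam_hom :: "nat \<Rightarrow> nat \<Rightarrow> (int \<Rightarrow> int) set set" where
  "Lam_hom n m = shift_class m ` periodic_maps n m"

definition Lam_id :: "nat \<Rightarrow> (int \<Rightarrow> int) set" where
  "Lam_id n = shift_class n id"

text \<open>Composition of classes as the set of all composites of representatives; by the lemma
  below this set is again exactly one class.\<close>

definition Lam_comp :: "(int \<Rightarrow> int) set \<Rightarrow> (int \<Rightarrow> int) set \<Rightarrow> (int \<Rightarrow> int) set" (infixr "\<odot>" 75) where
  "\<Phi> \<odot> \<Psi> = {f \<circ> g | f g. f \<in> \<Phi> \<and> g \<in> \<Psi>}"

lemma periodic_maps_shift:
  assumes "f \<in> periodic_maps n m"
  shows "f (x + k * (int n + 1)) = f x + k * (int m + 1)"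
proof -
  have step: "f (y + (int n + 1)) = f y + (int m + 1)" for y
    using assms by (simp add: periodic_maps_def add.assoc)
  show ?thesis
  proof (induction k rule: int_induct[where k = 0])
    case base
    show ?case by simp
  next
    case (step1 i)
    then show ?case
      using step[of "x + i * (int n + 1)"] by (simp add: algebra_simps)
  next
    case (step2 i)
    then show ?case
      using step[of "x + (i - 1) * (int n + 1)"] by (simp add: algebra_simps)
  qed
qed

lemma Lam_comp_shift_class:
  assumes "f \<in> periodic_maps m l"
  shows "shift_class l f \<odot> shift_class m g = shift_class l (f \<circ> g)"
proof
  show "shift_class l f \<odot> shift_class m g \<subseteq> shift_class l (f \<circ> g)"
  proof
    fix h assume "h \<in> shift_class l f \<odot> shift_class m g"
    then obtain j k where "h = (\<lambda>x. f x + j * (int l + 1)) \<circ> (\<lambda>x. g x + k * (int m + 1))"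
      by (auto simp: Lam_comp_def shift_class_def)
    then have "h = (\<lambda>x. f (g x) + k * (int l + 1) + j * (int l + 1))"
      by (simp only: comp_def periodic_maps_shift[OF assms])
    then have "h = (\<lambda>x. (f \<circ> g) x + (k + j) * (int l + 1))"
      by (simp add: fun_eq_iff distrib_right)
    then show "h \<in> shift_class l (f \<circ> g)"
      by (auto simp: shift_class_def)
  qed
next
  show "shift_class l (f \<circ> g) \<subseteq> shift_class l f \<odot> shift_class m g"
  proof
    fix h assume "h \<in> shift_class l (f \<circ> g)"
    then obtain k where h: "h = (\<lambda>x. f x + k * (int l + 1)) \<circ> g"
      by (auto simp: shift_class_def comp_def)
    have "(\<lambda>x. f x + k * (int l + 1)) \<in> shift_class l f"
      by (auto simp: shift_class_def)
    moreover have "g \<in> shift_class m g"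
      unfolding shift_class_def by (rule image_eqI[where x = 0]) auto
    ultimately show "h \<in> shift_class l f \<odot> shift_class m g"
      unfolding Lam_comp_def h by blast
  qed
qed

definition Lam_aut :: "nat \<Rightarrow> (int \<Rightarrow> int) set set" where
  "Lam_aut n = {\<gamma> \<in> Lam_hom n n. \<exists>\<delta> \<in> Lam_hom n n. \<gamma> \<odot> \<delta> = Lam_id n \<and> \<delta> \<odot> \<gamma> = Lam_id n}"

definition Lam_inv :: "nat \<Rightarrow> (int \<Rightarrow> int) set \<Rightarrow> (int \<Rightarrow> int) set" where
  "Lam_inv n \<gamma> = (THE \<delta>. \<delta> \<in> Lam_hom n n \<and> \<gamma> \<odot> \<delta> = Lam_id n \<and> \<delta> \<odot> \<gamma> = Lam_id n)"

definition tau :: "nat \<Rightarrow> (int \<Rightarrow> int) set" where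
  "tau n = shift_class n (\<lambda>x. x - 1)"

definition tau_pow :: "nat \<Rightarrow> nat \<Rightarrow> (int \<Rightarrow> int) set" where
  "tau_pow n a = (((\<odot>) (tau n)) ^^ a) (Lam_id n)"

text \<open>The inclusion of the simplicial into the cyclic category: periodic extension.\<close>

definition periodic_ext :: "nat \<Rightarrow> nat \<Rightarrow> (nat \<Rightarrow> nat) \<Rightarrow> int \<Rightarrow> int" where
  "periodic_ext n m f x =
     int (f (nat (x mod (int n + 1)))) + (x div (int n + 1)) * (int m + 1)"

definition Delta_to_Lam :: "nat \<Rightarrow> nat \<Rightarrow> (nat \<Rightarrow> nat) \<Rightarrow> (int \<Rightarrow> int) set" where
  "Delta_to_Lam n m f = shift_class m (periodic_ext n m f)"

text \<open>The two components of the unique factorization of \<open>\<phi> \<in> Lam_hom m n\<close> as an automorphism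
  of \<open>[m]\<close> followed by a map from the simplicial category.\<close>

definition delta_part :: "nat \<Rightarrow> nat \<Rightarrow> (int \<Rightarrow> int) set \<Rightarrow> nat \<Rightarrow> nat" where
  "delta_part m n \<phi> =
     (THE h. h \<in> Delta_hom m n \<and> (\<exists>\<gamma> \<in> Lam_aut m. \<phi> = Delta_to_Lam m n h \<odot> \<gamma>))"

definition aut_part :: "nat \<Rightarrow> nat \<Rightarrow> (int \<Rightarrow> int) set \<Rightarrow> (int \<Rightarrow> int) set" where
  "aut_part m n \<phi> =
     (THE \<gamma>. \<gamma> \<in> Lam_aut m \<and> (\<exists>h \<in> Delta_hom m n. \<phi> = Delta_to_Lam m n h \<odot> \<gamma>))"


section \<open>Simplicial and cyclic sets\<close>

text \<open>For \<open>\<phi> : [m] \<rightarrow> [n]\<close> and \<open>x \<in> obj S n\<close>, the element \<open>x\<phi>\<close> of \<open>obj S m\<close> is \<open>act S m n x \<phi>\<close>.\<close>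

record ('m, 's) presheaf =
  obj :: "nat \<Rightarrow> 's set"
  act :: "nat \<Rightarrow> nat \<Rightarrow> 's \<Rightarrow> 'm \<Rightarrow> 's"

type_synonym 's simplicial = "(nat \<Rightarrow> nat, 's) presheaf"
type_synonym 's cyclic = "((int \<Rightarrow> int) set, 's) presheaf"

definition simplicial_set :: "'s simplicial \<Rightarrow> bool" where
  "simplicial_set S \<longleftrightarrow>
     (\<forall>m n. \<forall>x \<in> obj S n. \<forall>\<phi> \<in> Delta_hom m n. act S m n x \<phi> \<in> obj S m) \<and>
     (\<forall>n. \<forall>x \<in> obj S n. act S n n x (Delta_id n) = x) \<and>
     (\<forall>l m n. \<forall>x \<in> obj S n. \<forall>\<phi> \<in> Delta_hom m n. \<forall>\<psi> \<in> Delta_hom l m.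
        act S l n x (Delta_comp l \<phi> \<psi>) = act S l m (act S m n x \<phi>) \<psi>)"

definition cyclic_set :: "'s cyclic \<Rightarrow> bool" where
  "cyclic_set S \<longleftrightarrow>
     (\<forall>m n. \<forall>x \<in> obj S n. \<forall>\<phi> \<in> Lam_hom m n. act S m n x \<phi> \<in> obj S m) \<and>
     (\<forall>n. \<forall>x \<in> obj S n. act S n n x (Lam_id n) = x) \<and>
     (\<forall>l m n. \<forall>x \<in> obj S n. \<forall>\<phi> \<in> Lam_hom m n. \<forall>\<psi> \<in> Lam_hom l m.
        act S l n x (\<phi> \<odot> \<psi>) = act S l m (act S m n x \<phi>) \<psi>)"

definition underlying_simplicial :: "'s cyclic \<Rightarrow> 's simplicial" where
  "underlying_simplicial S =
     \<lparr>obj = obj S, act = (\<lambda>m n x \<phi>. act S m n x (Delta_to_Lam m n \<phi>))\<rparr>"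

definition C_cyc :: "(int \<Rightarrow> int) set cyclic" where
  "C_cyc = \<lparr>obj = Lam_aut, act = (\<lambda>m n \<gamma> \<phi>. aut_part m n (\<gamma> \<odot> \<phi>))\<rparr>"


section \<open>The point associated to the interval and its cyclic structure\<close>

text \<open>A tuple \<open>(g\<^sub>0,\<dots>,g\<^sub>n)\<close> is a list of length \<open>n + 1\<close>.\<close>

definition F_obj :: "('g, 'b) monoid_scheme \<Rightarrow> 'g set \<Rightarrow> 'g \<Rightarrow> nat \<Rightarrow> 'g list set" where
  "F_obj G P z n = {g. length g = Suc n \<and> set g \<subseteq> P \<and> list_mult G g = z}"

definition F_Delta :: "('g, 'b) monoid_scheme \<Rightarrow> nat \<Rightarrow> nat \<Rightarrow> (nat \<Rightarrow> nat) \<Rightarrow> 'g list \<Rightarrow> 'g list" where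
  "F_Delta G n m \<phi> g =
     map (\<lambda>j. list_mult G (map (\<lambda>i. g ! i) (filter (\<lambda>i. \<phi> i = j) [0..<Suc n]))) [0..<Suc m]"

text \<open>\<open>\<tau>\<^sub>n\<close> acts by \<open>(g\<^sub>0,\<dots>,g\<^sub>n) \<mapsto> (g\<^sub>1,\<dots>,g\<^sub>n,g\<^sub>0)\<close>, so \<open>\<tau>\<^sub>n\<^sup>a\<close> acts by \<open>rotate a = rotate1 ^^ a\<close>.\<close>

definition F_aut :: "nat \<Rightarrow> (int \<Rightarrow> int) set \<Rightarrow> 'g list \<Rightarrow> 'g list" where
  "F_aut n \<gamma> g = rotate (THE a. a \<le> n \<and> \<gamma> = tau_pow n a) g"

text \<open>The value of \<open>F\<close> on an arbitrary \<open>\<phi> : [n] \<rightarrow> [m]\<close> of the cyclic category is forced by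
  functoriality and the factorization of \<open>\<phi>\<close>.\<close>

definition F_Lam :: "('g, 'b) monoid_scheme \<Rightarrow> nat \<Rightarrow> nat \<Rightarrow> (int \<Rightarrow> int) set \<Rightarrow> 'g list \<Rightarrow> 'g list" where
  "F_Lam G n m \<phi> g = F_Delta G n m (delta_part n m \<phi>) (F_aut n (aut_part n m \<phi>) g)"


section \<open>The inverse image of a simplicial set\<close>

type_synonym ('s, 'g) pre_point = "nat \<times> 's \<times> 'g list"

definition pre_points ::
  "('g, 'b) monoid_scheme \<Rightarrow> 'g set \<Rightarrow> 'g \<Rightarrow> 's simplicial \<Rightarrow> ('s, 'g) pre_point set" where
  "pre_points G P z S = (SIGMA n : UNIV. obj S n \<times> F_obj G P z n)"

inductive glue ::
  "('g, 'b) monoid_scheme \<Rightarrow> 'g set \<Rightarrow> 'g \<Rightarrow> 's simplicial \<Rightarrow>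
   ('s, 'g) pre_point \<Rightarrow> ('s, 'g) pre_point \<Rightarrow> bool"
  for G P z S where
  glueI: "\<lbrakk>\<phi> \<in> Delta_hom m n; x \<in> obj S n; g \<in> F_obj G P z m\<rbrakk>
    \<Longrightarrow> glue G P z S (m, act S m n x \<phi>, g) (n, x, F_Delta G m n \<phi> g)"

definition glue_equiv ::
  "('g, 'b) monoid_scheme \<Rightarrow> 'g set \<Rightarrow> 'g \<Rightarrow> 's simplicial \<Rightarrow>
   (('s, 'g) pre_point \<times> ('s, 'g) pre_point) set" where
  "glue_equiv G P z S =
     {(u, v). u \<in> pre_points G P z S \<and> v \<in> pre_points G P z S \<and> equivclp (glue G P z S) u v}"

definition realization ::
  "('g, 'b) monoid_scheme \<Rightarrow> 'g set \<Rightarrow> 'g \<Rightarrow> 's simplicial \<Rightarrow> ('s, 'g) pre_point set set" where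
  "realization G P z S = pre_points G P z S // glue_equiv G P z S"

text \<open>For a cyclic set \<open>S\<close>: the set \<open>|S|\<^sub>p\<close> and the class of \<open>(x, g)\<close> with \<open>x \<in> obj S n\<close>.\<close>

definition cyc_realization ::
  "('g, 'b) monoid_scheme \<Rightarrow> 'g set \<Rightarrow> 'g \<Rightarrow> 's cyclic \<Rightarrow> ('s, 'g) pre_point set set" where
  "cyc_realization G P z S = realization G P z (underlying_simplicial S)"

definition cyc_class ::
  "('g, 'b) monoid_scheme \<Rightarrow> 'g set \<Rightarrow> 'g \<Rightarrow> 's cyclic \<Rightarrow> nat \<Rightarrow> 's \<Rightarrow> 'g list \<Rightarrow> ('s, 'g) pre_point set" where
  "cyc_class G P z S n x g = glue_equiv G P z (underlying_simplicial S) `` {(n, x, g)}"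


section \<open>Group laws and right actions\<close>

text \<open>In the next three definitions the operations are required to be extensional, i.e. undefined
  off the relevant sets, so that uniqueness of the operation on those sets is equality in HOL.\<close>

definition C_group_law ::
  "('g, 'b) monoid_scheme \<Rightarrow> 'g set \<Rightarrow> 'g \<Rightarrow> ((int \<Rightarrow> int) set, 'g) pre_point set monoid \<Rightarrow> bool" where
  "C_group_law G P z M \<longleftrightarrow>
     group M \<and>
     carrier M = cyc_realization G P z C_cyc \<and>
     mult M \<in> carrier M \<rightarrow>\<^sub>E (carrier M \<rightarrow>\<^sub>E carrier M) \<and>
     (\<forall>n. \<forall>\<gamma> \<in> Lam_aut n. \<forall>\<gamma>' \<in> Lam_aut n. \<forall>g \<in> F_obj G P z n.
        cyc_class G P z C_cyc n \<gamma> g \<otimes>\<^bsub>M\<^esub> cyc_class G P z C_cyc n \<gamma>' (F_Lam G n n \<gamma> g)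
          = cyc_class G P z C_cyc n (\<gamma> \<odot> \<gamma>') g)"

definition is_iota ::
  "('g, 'b) monoid_scheme \<Rightarrow> 'g set \<Rightarrow> 'g \<Rightarrow>
   (((int \<Rightarrow> int) set, 'g) pre_point set \<Rightarrow> 'g set) \<Rightarrow> bool" where
  "is_iota G P z \<iota> \<longleftrightarrow>
     \<iota> \<in> extensional (cyc_realization G P z C_cyc) \<and>
     (\<forall>n a. \<forall>g \<in> F_obj G P z n. a \<le> n \<longrightarrow>
        \<iota> (cyc_class G P z C_cyc n (tau_pow n a) g)
          = int_powers G z #>\<^bsub>G\<^esub> list_mult G (take a g))"

definition right_group_action :: "('c, 'd) monoid_scheme \<Rightarrow> 'x set \<Rightarrow> ('x \<Rightarrow> 'c \<Rightarrow> 'x) \<Rightarrow> bool" where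
  "right_group_action M X A \<longleftrightarrow>
     A \<in> X \<rightarrow>\<^sub>E (carrier M \<rightarrow>\<^sub>E X) \<and>
     (\<forall>x \<in> X. A x \<one>\<^bsub>M\<^esub> = x) \<and>
     (\<forall>x \<in> X. \<forall>c \<in> carrier M. \<forall>d \<in> carrier M. A (A x c) d = A x (c \<otimes>\<^bsub>M\<^esub> d))"

end

theory Submission
  imports Defs
begin

text \<open>
  A tuple \<open>g \<in> F(n)\<close> is the same as its sequence of partial products \<open>\<beta>\<close>, extended to all integers by
  \<open>\<beta>(k + n + 1) = z \<beta>(k)\<close>. Morphisms of the simplicial category act by reindexing \<open>\<beta>\<close> along an
  adjoint, and \<open>\<tau>\<^sup>a\<close> sends \<open>\<beta>\<close> to \<open>k \<mapsto> \<beta>(a)\<^sup>-\<^sup>1 \<beta>(a + k)\<close>. Hence \<open>(\<tau>\<^sup>a, g) \<mapsto> \<beta>(a)\<close> is compatible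
  with the gluing relation, and since every class has a representative
  \<open>(\<tau>\<^sub>1, (h, h\<^sup>-\<^sup>1 z))\<close> with \<open>1 \<le> h < z\<close>, it identifies \<open>|C|\<^sub>p\<close> with \<open>G'/z\<^sup>\<int>\<close>. The group law is
  transported along this bijection; it is unique because inserting further vertices into \<open>g\<close> brings any
  finite number of points of \<open>|C|\<^sub>p\<close> and a point of \<open>|S|\<^sub>p\<close> to a common tuple.

  For the action of the class of \<open>h\<close> on \<open>(x, g)\<close>, choose \<open>i\<close> with \<open>\<beta>(i) \<le> h < \<beta>(i + 1)\<close>, insert \<open>h\<close>
  as a new vertex and rotate it to position 0. As \<open>i\<close> is unique, a simplicial morphism \<open>\<phi>\<close> sends it to the
  corresponding index \<open>\<phi>(i)\<close>, so the construction respects the gluing relation; it agrees with the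
  prescribed formula because vertices that coincide can be rotated across each other.
\<close>

section \<open>Morphisms of the cyclic category\<close>

lemma shift_class_eq_iff:
  "shift_class n f = shift_class n g \<longleftrightarrow> (\<exists>k. \<forall>x. f x = g x + k * (int n + 1))"
proof
  assume eq: "shift_class n f = shift_class n g"
  have "f \<in> shift_class n f"
    unfolding shift_class_def by (rule image_eqI[where x = 0]) auto
  then show "\<exists>k. \<forall>x. f x = g x + k * (int n + 1)"
    unfolding eq by (auto simp: shift_class_def)
next
  assume "\<exists>k. \<forall>x. f x = g x + k * (int n + 1)"
  then obtain k where k: "f x = g x + k * (int n + 1)" for x by blast
  have "(\<lambda>j x. f x + j * (int n + 1)) = (\<lambda>j x. g x + j * (int n + 1)) \<circ> (\<lambda>j. j + k)"
    by (simp add: k comp_def fun_eq_iff distrib_right)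
  moreover have "range (\<lambda>j. j + k) = UNIV"
    by (rule surjI[of _ "\<lambda>j. j - k"]) simp
  ultimately show "shift_class n f = shift_class n g"
    unfolding shift_class_def by (simp only: image_comp[symmetric])
qed

lemma shift_class_eqI: "(\<And>x. f x = g x) \<Longrightarrow> shift_class n f = shift_class n g"
  by (metis ext)

lemma periodic_maps_mono: "f \<in> periodic_maps m n \<Longrightarrow> x \<le> y \<Longrightarrow> f x \<le> f y"
  by (auto simp: periodic_maps_def mono_def)

lemma periodic_maps_comp:
  assumes "f \<in> periodic_maps m n" "g \<in> periodic_maps l m"
  shows "f \<circ> g \<in> periodic_maps l n"
  using assms by (auto simp: periodic_maps_def mono_def)

lemma periodic_maps_add: "(\<lambda>x. x + c) \<in> periodic_maps n n"
  by (auto simp: periodic_maps_def mono_def)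

lemma periodic_maps_eqI:
  assumes f: "f \<in> periodic_maps m n" and g: "g \<in> periodic_maps m n"
    and eq: "\<And>x. 0 \<le> x \<Longrightarrow> x \<le> int m \<Longrightarrow> f x = g x"
  shows "f = g"
proof
  fix x
  have "f (x mod (int m + 1)) = g (x mod (int m + 1))"
    using pos_mod_bound[of "int m + 1" x] by (intro eq) auto
  then show "f x = g x"
    using periodic_maps_shift[OF f, of "x mod (int m + 1)" "x div (int m + 1)"]
      periodic_maps_shift[OF g, of "x mod (int m + 1)" "x div (int m + 1)"]
    by (simp only: mod_mult_div_eq mult.commute[of _ "int m + 1"])
qed

lemma shift_class_in_Lam_hom: "f \<in> periodic_maps m n \<Longrightarrow> shift_class n f \<in> Lam_hom m n"
  by (auto simp: Lam_hom_def)

text \<open>Translations by arbitrary integers replace the powers of \<open>tau n\<close>: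
  composition becomes addition, inversion a change of sign, and two indices give the same class
  exactly when they agree modulo n + 1.\<close>

definition rot :: "nat \<Rightarrow> int \<Rightarrow> (int \<Rightarrow> int) set" where
  "rot n c = shift_class n (\<lambda>x. x + c)"

lemma rot_in_Lam_hom: "rot n c \<in> Lam_hom n n"
  unfolding rot_def by (intro shift_class_in_Lam_hom periodic_maps_add)

lemma rot_comp: "rot n c \<odot> rot n d = rot n (c + d)"
  unfolding rot_def Lam_comp_shift_class[OF periodic_maps_add]
  by (intro shift_class_eqI) auto

lemma rot_eq_iff: "rot n c = rot n d \<longleftrightarrow> (int n + 1) dvd c - d"
  unfolding rot_def shift_class_eq_iff dvd_def by (auto simp: algebra_simps)

lemma Lam_id_rot: "Lam_id n = rot n 0"
  unfolding Lam_id_def rot_def by (intro shift_class_eqI) auto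

lemma rot_period: "rot n (int (Suc n)) = Lam_id n"
  by (simp add: Lam_id_rot rot_eq_iff add.commute)

lemma tau_pow_rot: "tau_pow n a = rot n (- int a)"
proof (induction a)
  case (Suc a)
  have "tau n = rot n (- 1)"
    unfolding tau_def rot_def by (intro shift_class_eqI) auto
  then show ?case
    using Suc by (simp add: tau_pow_def rot_comp)
qed (simp add: tau_pow_def Lam_id_rot)

text \<open>A representative of an invertible class is a non-decreasing bijection of the integers,
  so it advances by exactly 1 at each step and is a translation.\<close>

lemma Lam_aut_rot: "Lam_aut n = range (rot n)"
proof
  show "range (rot n) \<subseteq> Lam_aut n"
  proof clarify
    fix c
    have "rot n c \<odot> rot n (- c) = Lam_id n" "rot n (- c) \<odot> rot n c = Lam_id n"
      by (simp_all add: rot_comp Lam_id_rot)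
    then show "rot n c \<in> Lam_aut n"
      unfolding Lam_aut_def using rot_in_Lam_hom by blast
  qed
next
  show "Lam_aut n \<subseteq> range (rot n)"
  proof
    fix \<gamma> assume "\<gamma> \<in> Lam_aut n"
    then obtain f g where f: "f \<in> periodic_maps n n" "\<gamma> = shift_class n f"
      and g: "g \<in> periodic_maps n n"
      and eqs: "shift_class n f \<odot> shift_class n g = Lam_id n"
        "shift_class n g \<odot> shift_class n f = Lam_id n"
      by (auto simp: Lam_aut_def Lam_hom_def)
    from eqs obtain j k where j: "\<And>x. f (g x) = x + j * (int n + 1)"
      and k: "\<And>x. g (f x) = x + k * (int n + 1)"
      unfolding Lam_comp_shift_class[OF f(1)] Lam_comp_shift_class[OF g] Lam_id_def
        shift_class_eq_iff by auto
    have surj: "\<exists>x. f x = y" for y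
      using j[of "y - j * (int n + 1)"] by auto
    have mono: "f x \<le> f y" if "x \<le> y" for x y
      using periodic_maps_mono[OF f(1) that] .
    have inj: "x = y" if "f x = f y" for x y
      using arg_cong[OF that, of g] unfolding k by simp
    \<comment> \<open>The value \<open>f x + 1\<close> is attained, necessarily to the right of
      \<open>x\<close>, so monotonicity leaves no gap between \<open>f x\<close> and
      \<open>f (x + 1)\<close>.\<close>
    have step: "f (x + 1) = f x + 1" for x
    proof -
      have "f x \<noteq> f (x + 1)" using inj[of x "x + 1"] by auto
      with mono[of x "x + 1"] have lt: "f x < f (x + 1)" by simp
      obtain y where y: "f y = f x + 1" using surj by blast
      have "x < y" using mono[of y x] y by (cases "x < y") auto
      then have "f (x + 1) \<le> f y" by (intro mono) simp
      with lt y show ?thesis by simp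
    qed
    have "f x = x + f 0" for x
    proof (induction x rule: int_induct[where k = 0])
      case (step1 i) then show ?case using step[of i] by simp
    next
      case (step2 i) then show ?case using step[of "i - 1"] by simp
    qed simp
    then have "\<gamma> = rot n (f 0)"
      unfolding f(2) rot_def by (intro shift_class_eqI)
    then show "\<gamma> \<in> range (rot n)" by blast
  qed
qed

lemma rot_in_Lam_aut: "rot n c \<in> Lam_aut n"
  by (simp add: Lam_aut_rot)

lemma Lam_aut_cases:
  assumes "\<gamma> \<in> Lam_aut n"
  obtains a where "a \<le> n" "\<gamma> = rot n (- int a)"
proof -
  obtain c where c: "\<gamma> = rot n c"
    using assms by (auto simp: Lam_aut_rot)
  define a where "a = nat ((- c) mod (int n + 1))"
  have a: "int a = (- c) mod (int n + 1)"
    by (simp add: a_def)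
  have "a \<le> n"
    using a pos_mod_bound[of "int n + 1" "- c"] by linarith
  moreover have "c - - int a = (int n + 1) * - (- c div (int n + 1))"
    using mult_div_mod_eq[of "int n + 1" "- c"] unfolding a mult_minus_right by linarith
  then have "\<gamma> = rot n (- int a)"
    unfolding c rot_eq_iff by (rule dvdI)
  ultimately show ?thesis
    by (rule that)
qed

lemma rot_neg_inj: "a \<le> n \<Longrightarrow> b \<le> n \<Longrightarrow> rot n (- int a) = rot n (- int b) \<Longrightarrow> a = b"
proof -
  assume "a \<le> n" "b \<le> n" "rot n (- int a) = rot n (- int b)"
  then have "(int n + 1) dvd int b - int a"
    by (simp add: rot_eq_iff)
  moreover have "\<bar>int b - int a\<bar> < int n + 1"
    using \<open>a \<le> n\<close> \<open>b \<le> n\<close> by auto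
  ultimately show "a = b"
    using dvd_imp_le_int[of "int b - int a" "int n + 1"] by linarith
qed

lemma Lam_inv_rot: "Lam_inv n (rot n c) = rot n (- c)"
  unfolding Lam_inv_def
proof (rule the_equality)
  show "rot n (- c) \<in> Lam_hom n n \<and> rot n c \<odot> rot n (- c) = Lam_id n \<and> rot n (- c) \<odot> rot n c = Lam_id n"
    by (simp add: rot_in_Lam_hom rot_comp Lam_id_rot)
next
  fix \<delta> assume \<delta>: "\<delta> \<in> Lam_hom n n \<and> rot n c \<odot> \<delta> = Lam_id n \<and> \<delta> \<odot> rot n c = Lam_id n"
  then have "\<delta> \<in> Lam_aut n"
    unfolding Lam_aut_def using rot_in_Lam_hom by blast
  then obtain d where d: "\<delta> = rot n d" by (auto simp: Lam_aut_rot)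
  with \<delta> have "rot n (c + d) = rot n 0"
    by (simp add: rot_comp Lam_id_rot)
  then show "\<delta> = rot n (- c)"
    unfolding d rot_eq_iff by (metis diff_minus_eq_add diff_zero add.commute)
qed

section \<open>Simplicial maps as periodic maps, and the factorization of cyclic morphisms\<close>

lemma Delta_hom_le: "\<phi> \<in> Delta_hom m n \<Longrightarrow> i \<le> m \<Longrightarrow> \<phi> i \<le> n"
  by (auto simp: Delta_hom_def)

lemma Delta_hom_mono: "\<phi> \<in> Delta_hom m n \<Longrightarrow> i \<le> j \<Longrightarrow> j \<le> m \<Longrightarrow> \<phi> i \<le> \<phi> j"
  by (auto simp: Delta_hom_def mono_on_def)

lemma Delta_homI:
  assumes "\<And>i. i \<le> m \<Longrightarrow> f i \<le> n" "\<And>i j. i \<le> j \<Longrightarrow> j \<le> m \<Longrightarrow> f i \<le> f j"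
  shows "restrict f {..m} \<in> Delta_hom m n"
  using assms by (auto simp: Delta_hom_def mono_on_def)

lemma periodic_ext_shift:
  "periodic_ext m n \<phi> (x + k * (int m + 1)) = periodic_ext m n \<phi> x + k * (int n + 1)"
proof -
  have "(x + k * (int m + 1)) mod (int m + 1) = x mod (int m + 1)"
    "(x + k * (int m + 1)) div (int m + 1) = k + x div (int m + 1)"
    by (rule mod_mult_self1, rule div_mult_self1) simp
  then show ?thesis
    unfolding periodic_ext_def by (simp only: distrib_right)
qed

lemma periodic_ext_of_nat: "i \<le> m \<Longrightarrow> periodic_ext m n \<phi> (int i) = int (\<phi> i)"
  unfolding periodic_ext_def by simp

lemma periodic_ext_in_periodic_maps:
  assumes \<phi>: "\<phi> \<in> Delta_hom m n"
  shows "periodic_ext m n \<phi> \<in> periodic_maps m n"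
proof -
  have "periodic_ext m n \<phi> x \<le> periodic_ext m n \<phi> y" if xy: "x \<le> y" for x y
  proof -
    let ?M = "int m + 1" and ?N = "int n + 1"
    have le: "nat (u mod ?M) \<le> m" for u
      using pos_mod_bound[of ?M u] pos_mod_sign[of ?M u] by linarith
    have "x div ?M \<le> y div ?M"
      using xy by (simp add: zdiv_mono1)
    then consider "x div ?M = y div ?M" | "x div ?M + 1 \<le> y div ?M" by linarith
    then show ?thesis
    proof cases
      case 1
      have "x mod ?M \<le> y mod ?M"
        using xy 1 by (metis add_le_cancel_left div_mult_mod_eq)
      then have "\<phi> (nat (x mod ?M)) \<le> \<phi> (nat (y mod ?M))"
        by (intro Delta_hom_mono[OF \<phi>] le nat_mono)
      with 1 show ?thesis by (simp add: periodic_ext_def)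
    next
      case 2
      then have "(x div ?M + 1) * ?N \<le> (y div ?M) * ?N"
        by (intro mult_right_mono) auto
      moreover have "int (\<phi> (nat (x mod ?M))) < ?N"
        using Delta_hom_le[OF \<phi> le, of x] by linarith
      ultimately show ?thesis
        unfolding periodic_ext_def distrib_right mult_1_left by (smt (verit) of_nat_0_le_iff)
    qed
  qed
  moreover have "periodic_ext m n \<phi> (x + int m + 1) = periodic_ext m n \<phi> x + int n + 1" for x
    using periodic_ext_shift[of m n \<phi> x 1] by (simp add: add.assoc)
  ultimately show ?thesis
    by (auto simp: periodic_maps_def mono_def)
qed

lemma Delta_to_Lam_in_Lam_hom: "\<phi> \<in> Delta_hom m n \<Longrightarrow> Delta_to_Lam m n \<phi> \<in> Lam_hom m n"
  unfolding Delta_to_Lam_def by (intro shift_class_in_Lam_hom periodic_ext_in_periodic_maps)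

text \<open>The integer -1 goes to \<phi>(m) - (n + 1), which is negative. So an extension remembers
  where its source and target blocks begin; this is what fixes the translation in a
  factorization.\<close>

lemma periodic_ext_nonneg_iff:
  assumes \<phi>: "\<phi> \<in> Delta_hom m n"
  shows "0 \<le> periodic_ext m n \<phi> x \<longleftrightarrow> 0 \<le> x"
proof
  have "periodic_ext m n \<phi> (-1) < 0"
    using periodic_ext_shift[of m n \<phi> "int m" "-1"] Delta_hom_le[OF \<phi> order_refl]
    by (simp add: periodic_ext_of_nat)
  then show "0 \<le> x" if "0 \<le> periodic_ext m n \<phi> x"
    using periodic_maps_mono[OF periodic_ext_in_periodic_maps[OF \<phi>], of x "-1"] that by linarith
next
  have "0 \<le> periodic_ext m n \<phi> 0"
    using periodic_ext_of_nat[of 0 m n \<phi>] by simp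
  then show "0 \<le> periodic_ext m n \<phi> x" if "0 \<le> x"
    using periodic_maps_mono[OF periodic_ext_in_periodic_maps[OF \<phi>] that] by linarith
qed

text \<open>Recognizes simplicial maps among periodic ones. By monotonicity the two end points
  decide whether the block from 0 to m lands in the block from 0 to n.\<close>

lemma Delta_hom_of_periodic:
  assumes f: "f \<in> periodic_maps m n" and "0 \<le> f 0" "f (int m) \<le> int n"
  obtains \<phi> where "\<phi> \<in> Delta_hom m n" "periodic_ext m n \<phi> = f"
proof -
  define \<phi> where "\<phi> = restrict (\<lambda>i. nat (f (int i))) {..m}"
  have bd: "0 \<le> f (int i)" "f (int i) \<le> int n" if "i \<le> m" for i
    using assms periodic_maps_mono[OF f, of 0 "int i"] periodic_maps_mono[OF f, of "int i" "int m"] that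
    by auto
  have \<phi>: "\<phi> \<in> Delta_hom m n"
    unfolding \<phi>_def by (intro Delta_homI nat_mono periodic_maps_mono[OF f]) (use bd in force)+
  moreover have "periodic_ext m n \<phi> = f"
  proof (rule periodic_maps_eqI[OF periodic_ext_in_periodic_maps[OF \<phi>] f])
    fix x assume x: "0 \<le> x" "x \<le> int m"
    then have "periodic_ext m n \<phi> (int (nat x)) = int (\<phi> (nat x))"
      by (intro periodic_ext_of_nat) auto
    then show "periodic_ext m n \<phi> x = f x"
      using x bd(1)[of "nat x"] by (simp add: \<phi>_def nat_le_iff)
  qed
  ultimately show ?thesis by (rule that)
qed

lemma periodic_ext_cong_imp_eq:
  assumes "\<phi> \<in> Delta_hom m n" "\<psi> \<in> Delta_hom m n" "periodic_ext m n \<phi> = periodic_ext m n \<psi>"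
  shows "\<phi> = \<psi>"
proof
  fix i
  show "\<phi> i = \<psi> i"
  proof (cases "i \<le> m")
    case True
    then show ?thesis
      using periodic_ext_of_nat[of i m n \<phi>] periodic_ext_of_nat[of i m n \<psi>] assms(3) by simp
  next
    case False
    then show ?thesis
      using assms by (auto simp: Delta_hom_def PiE_def extensional_def)
  qed
qed

lemma Delta_to_Lam_comp_rot:
  assumes "\<phi> \<in> Delta_hom m n"
  shows "Delta_to_Lam m n \<phi> \<odot> rot m c = shift_class n (\<lambda>x. periodic_ext m n \<phi> (x + c))"
  unfolding Delta_to_Lam_def rot_def Lam_comp_shift_class[OF periodic_ext_in_periodic_maps[OF assms]]
  by (simp add: comp_def)

text \<open>The two extensions differ by a translation of the argument. Both are non-negative
  exactly on the non-negative integers, so testing at 0 and at -1 forces this translation to be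
  trivial.\<close>

lemma factorization_unique:
  assumes \<phi>: "\<phi> \<in> Delta_hom m n" and \<psi>: "\<psi> \<in> Delta_hom m n"
    and eq: "Delta_to_Lam m n \<phi> \<odot> rot m c = Delta_to_Lam m n \<psi> \<odot> rot m d"
  shows "\<phi> = \<psi>" "rot m c = rot m d"
proof -
  obtain k where k: "\<And>x. periodic_ext m n \<phi> (x + c) = periodic_ext m n \<psi> (x + d) + k * (int n + 1)"
    using eq unfolding Delta_to_Lam_comp_rot[OF \<phi>] Delta_to_Lam_comp_rot[OF \<psi>] shift_class_eq_iff
    by blast
  \<comment> \<open>Periodicity moves the ambiguity \<open>k\<close> of the representative from the
    target to the source, where it joins the two rotations.\<close>
  define e where "e = d - c + k * (int m + 1)"
  have e: "periodic_ext m n \<phi> x = periodic_ext m n \<psi> (x + e)" for x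
    using k[of "x - c"] periodic_ext_shift[of m n \<psi> "x - c + d" k]
    by (simp add: e_def algebra_simps)
  have "0 \<le> e"
    using e[of 0] periodic_ext_nonneg_iff[OF \<phi>, of 0] periodic_ext_nonneg_iff[OF \<psi>, of e] by simp
  moreover have "\<not> 0 \<le> e - 1"
    using e[of "-1"] periodic_ext_nonneg_iff[OF \<phi>, of "-1"] periodic_ext_nonneg_iff[OF \<psi>, of "e - 1"]
    by simp
  ultimately have "e = 0" by simp
  then show "\<phi> = \<psi>"
    using e by (intro periodic_ext_cong_imp_eq[OF \<phi> \<psi>]) auto
  have "c - d = k * (int m + 1)"
    using \<open>e = 0\<close> unfolding e_def by linarith
  then show "rot m c = rot m d"
    by (simp add: rot_eq_iff)
qed

lemma delta_part_eq:
  assumes "\<phi> \<in> Delta_hom m n"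
  shows "delta_part m n (Delta_to_Lam m n \<phi> \<odot> rot m c) = \<phi>"
  unfolding delta_part_def
proof (rule the_equality)
  show "\<phi> \<in> Delta_hom m n \<and>
    (\<exists>\<gamma>\<in>Lam_aut m. Delta_to_Lam m n \<phi> \<odot> rot m c = Delta_to_Lam m n \<phi> \<odot> \<gamma>)"
    using assms rot_in_Lam_aut by blast
next
  fix \<psi>
  assume "\<psi> \<in> Delta_hom m n \<and>
    (\<exists>\<gamma>\<in>Lam_aut m. Delta_to_Lam m n \<phi> \<odot> rot m c = Delta_to_Lam m n \<psi> \<odot> \<gamma>)"
  then show "\<psi> = \<phi>"
    unfolding Lam_aut_rot using factorization_unique(1)[OF assms] by blast
qed

lemma aut_part_eq:
  assumes "\<phi> \<in> Delta_hom m n"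
  shows "aut_part m n (Delta_to_Lam m n \<phi> \<odot> rot m c) = rot m c"
  unfolding aut_part_def
proof (rule the_equality)
  show "rot m c \<in> Lam_aut m \<and>
    (\<exists>\<psi>\<in>Delta_hom m n. Delta_to_Lam m n \<phi> \<odot> rot m c = Delta_to_Lam m n \<psi> \<odot> rot m c)"
    using assms rot_in_Lam_aut by blast
next
  fix \<gamma>
  assume "\<gamma> \<in> Lam_aut m \<and>
    (\<exists>\<psi>\<in>Delta_hom m n. Delta_to_Lam m n \<phi> \<odot> rot m c = Delta_to_Lam m n \<psi> \<odot> \<gamma>)"
  then show "\<gamma> = rot m c"
    unfolding Lam_aut_rot using factorization_unique(2)[OF assms] by blast
qed

lemma Delta_id_in_Delta_hom: "Delta_id n \<in> Delta_hom n n"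
  unfolding Delta_id_def by (intro Delta_homI) auto

lemma Delta_to_Lam_id: "Delta_to_Lam n n (Delta_id n) = Lam_id n"
proof -
  have "periodic_ext n n (Delta_id n) x = id x" for x
    using pos_mod_bound[of "int n + 1" x]
    by (auto simp: periodic_ext_def Delta_id_def nat_le_iff mod_div_mult_eq)
  then show ?thesis
    unfolding Delta_to_Lam_def Lam_id_def by (intro shift_class_eqI)
qed

lemma
  shows delta_part_rot: "delta_part n n (rot n c) = Delta_id n"
    and aut_part_rot: "aut_part n n (rot n c) = rot n c"
  using delta_part_eq[OF Delta_id_in_Delta_hom, of n c] aut_part_eq[OF Delta_id_in_Delta_hom, of n c]
  by (simp_all add: Delta_to_Lam_id Lam_id_rot rot_comp)

text \<open>Translating source and target moves the cut of \<phi> at level \<open>a\<close> to a cut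
  at level 0, which leaves a simplicial map. What remains is the translation by \<open>- b\<close>:
  the right action on \<open>C_cyc\<close> applies the left adjoint of \<phi> to exponents.\<close>

lemma aut_part_rot_Delta:
  assumes \<phi>: "\<phi> \<in> Delta_hom m n" and cut: "\<And>x. periodic_ext m n \<phi> x < a \<longleftrightarrow> x < b"
  shows "aut_part m n (rot n (- a) \<odot> Delta_to_Lam m n \<phi>) = rot m (- b)"
proof -
  note per = periodic_ext_in_periodic_maps[OF \<phi>]
  define f where "f = (\<lambda>x. x + - a) \<circ> (periodic_ext m n \<phi> \<circ> (\<lambda>x. x + b))"
  have f: "f \<in> periodic_maps m n"
    unfolding f_def by (rule periodic_maps_comp[OF periodic_maps_add periodic_maps_comp[OF per periodic_maps_add]])
  have "0 \<le> f 0" using cut[of b] by (simp add: f_def)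
  \<comment> \<open>The last index of the block, b + m, is one period after b - 1, and b - 1 lies
    just below the cut.\<close>
  moreover have "f (int m) \<le> int n"
    using cut[of "b - 1"] periodic_ext_shift[of m n \<phi> "b - 1" 1]
    by (simp add: f_def algebra_simps)
  ultimately obtain \<psi> where \<psi>: "\<psi> \<in> Delta_hom m n" "periodic_ext m n \<psi> = f"
    using Delta_hom_of_periodic[OF f] by blast
  have "rot n (- a) \<odot> Delta_to_Lam m n \<phi> = Delta_to_Lam m n \<psi> \<odot> rot m (- b)"
    unfolding Delta_to_Lam_comp_rot[OF \<psi>(1)] \<psi>(2)
    unfolding rot_def Delta_to_Lam_def Lam_comp_shift_class[OF periodic_maps_add]
    by (intro shift_class_eqI) (simp add: f_def)
  then show ?thesis by (simp add: aut_part_eq[OF \<psi>(1)])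
qed

section \<open>Cuts of non-decreasing maps\<close>

lemma cut_mono:
  assumes "(c::nat) \<le> Suc m" "\<And>i. i \<le> m \<Longrightarrow> i < c \<Longrightarrow> i < d"
  shows "c \<le> d"
proof (rule ccontr)
  assume "\<not> c \<le> d"
  \<comment> \<open>Cuts range up to m + 1, but if d < c then \<open>d\<close> itself is an index at
    most m that lies below \<open>c\<close> and not below \<open>d\<close>.\<close>
  then show False using assms(1) assms(2)[of d] by linarith
qed

lemma cut_unique:
  assumes "(c::nat) \<le> Suc m" "d \<le> Suc m" "\<And>i. i \<le> m \<Longrightarrow> i < c \<longleftrightarrow> i < d"
  shows "c = d"
  using assms by (intro antisym cut_mono[of c m d] cut_mono[of d m c]) blast+

text \<open>The cut is the least index not sent below \<open>l\<close>, or m + 1 if there is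
  none.\<close>

lemma Delta_cut_exists:
  assumes \<phi>: "\<phi> \<in> Delta_hom m n"
  obtains c where "c \<le> Suc m" "\<And>i. i \<le> m \<Longrightarrow> \<phi> i < l \<longleftrightarrow> i < c"
proof (cases "\<exists>i\<le>m. \<not> \<phi> i < l")
  case True
  define c where "c = (LEAST i. i \<le> m \<and> \<not> \<phi> i < l)"
  have c: "c \<le> m \<and> \<not> \<phi> c < l"
    unfolding c_def by (rule LeastI_ex[OF True])
  have cut: "\<phi> i < l \<longleftrightarrow> i < c" if i: "i \<le> m" for i
  proof
    assume "\<phi> i < l"
    then show "i < c"
      using Delta_hom_mono[OF \<phi> _ i, of c] c by linarith
  next
    assume "i < c"
    then show "\<phi> i < l"
      using not_less_Least[of i "\<lambda>i. i \<le> m \<and> \<not> \<phi> i < l"] i unfolding c_def by blast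
  qed
  have "c \<le> Suc m" using c by simp
  then show ?thesis using cut by (rule that)
next
  case False
  then have "\<phi> i < l \<longleftrightarrow> i < Suc m" if "i \<le> m" for i
    using that by (simp add: less_Suc_eq_le)
  then show ?thesis by (rule that[OF order_refl])
qed

text \<open>A non-decreasing \<open>\<phi>\<close> pushes a sequence \<open>\<beta>\<close> forward to \<open>\<beta> \<circ> \<phi>\<^sup>*\<close>, where the left
  adjoint \<open>\<phi>\<^sup>*\<close> is characterized by \<open>\<phi> x < l \<longleftrightarrow> x < \<phi>\<^sup>* l\<close>.\<close>

lemma periodic_ext_cut:
  assumes \<phi>: "\<phi> \<in> Delta_hom m n" and l: "l \<le> Suc n" and c: "c \<le> Suc m"
    and cut: "\<And>i. i \<le> m \<Longrightarrow> \<phi> i < l \<longleftrightarrow> i < c"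
  shows "periodic_ext m n \<phi> x < int l \<longleftrightarrow> x < int c"
proof -
  note mono = periodic_maps_mono[OF periodic_ext_in_periodic_maps[OF \<phi>]]
  consider "x < 0" | "0 \<le> x" "x \<le> int m" | "x > int m" by linarith
  then show ?thesis
  proof cases
    case 1
    then show ?thesis using periodic_ext_nonneg_iff[OF \<phi>, of x] by auto
  next
    case 2
    then show ?thesis
      using cut[of "nat x"] periodic_ext_of_nat[of "nat x" m n \<phi>] by auto
  next
    case 3
    have "periodic_ext m n \<phi> (int m + 1) \<ge> int n + 1"
      using periodic_ext_shift[of m n \<phi> 0 1] periodic_ext_nonneg_iff[OF \<phi>, of 0] by simp
    then have "periodic_ext m n \<phi> x \<ge> int n + 1"
      using mono[of "int m + 1" x] 3 by simp
    then show ?thesis using l c 3 by simp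
  qed
qed

lemma periodic_ext_cut_shift:
  assumes "\<And>x. periodic_ext m n \<phi> x < l \<longleftrightarrow> x < c"
  shows "periodic_ext m n \<phi> x < l + q * (int n + 1) \<longleftrightarrow> x < c + q * (int m + 1)"
  using assms[of "x - q * (int m + 1)"] periodic_ext_shift[of m n \<phi> "x - q * (int m + 1)" q]
  by auto

lemma periodic_ext_cut_exists:
  assumes \<phi>: "\<phi> \<in> Delta_hom m n"
  obtains c where "\<And>x. periodic_ext m n \<phi> x < l \<longleftrightarrow> x < c"
proof -
  define r where "r = nat (l mod (int n + 1))"
  have r: "int r = l mod (int n + 1)" by (simp add: r_def)
  have "r \<le> Suc n"
    using r pos_mod_bound[of "int n + 1" l] by linarith
  obtain c where "c \<le> Suc m" "\<And>i. i \<le> m \<Longrightarrow> \<phi> i < r \<longleftrightarrow> i < c"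
    using Delta_cut_exists[OF \<phi>] by blast
  then have "\<And>x. periodic_ext m n \<phi> x < int r \<longleftrightarrow> x < int c"
    by (intro periodic_ext_cut[OF \<phi> \<open>r \<le> Suc n\<close>])
  from periodic_ext_cut_shift[OF this, of _ "l div (int n + 1)"]
  show ?thesis
    by (intro that) (simp add: r mod_div_mult_eq)
qed

section \<open>Tuples and their partial products\<close>

definition pp :: "('g, 'b) monoid_scheme \<Rightarrow> 'g list \<Rightarrow> nat \<Rightarrow> 'g" where
  "pp G g k = list_mult G (take k g)"

text \<open>Serves for the fibres of a non-decreasing map, which are intervals of indices.\<close>

lemma filter_upt_slice:
  assumes "a \<le> b" "b \<le> M" "\<And>i. i < M \<Longrightarrow> p i \<longleftrightarrow> a \<le> i \<and> i < b"
  shows "filter p [0..<M] = [a..<b]"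
proof -
  have "[0..<M] = [0..<a] @ [a..<b] @ [b..<M]"
    using assms upt_add_eq_append[of 0 a "M - a"] upt_add_eq_append[of a b "M - b"] by simp
  moreover have "filter p [0..<a] = []" "filter p [a..<b] = [a..<b]" "filter p [b..<M] = []"
    using assms by (auto simp: filter_empty_conv filter_id_conv)
  ultimately show ?thesis by simp
qed

context group
begin

lemma mult_inv_cancel: "\<lbrakk>a \<in> carrier G; b \<in> carrier G\<rbrakk> \<Longrightarrow> a \<otimes> (inv a \<otimes> b) = b"
  by (simp add: m_assoc[symmetric])

lemma inv_mult_cancel: "\<lbrakk>a \<in> carrier G; b \<in> carrier G\<rbrakk> \<Longrightarrow> inv a \<otimes> (a \<otimes> b) = b"
  by (simp add: m_assoc[symmetric])

lemma inv_mult_cancel_left: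
  "\<lbrakk>a \<in> carrier G; b \<in> carrier G; c \<in> carrier G\<rbrakk> \<Longrightarrow> inv (a \<otimes> b) \<otimes> (a \<otimes> c) = inv b \<otimes> c"
  by (simp add: inv_mult_group m_assoc inv_mult_cancel)

lemma list_mult_closed [simp, intro]: "set gs \<subseteq> carrier G \<Longrightarrow> list_mult G gs \<in> carrier G"
  by (induction gs) (simp_all add: list_mult_def)

lemma list_mult_append:
  "\<lbrakk>set gs \<subseteq> carrier G; set hs \<subseteq> carrier G\<rbrakk> \<Longrightarrow>
    list_mult G (gs @ hs) = list_mult G gs \<otimes> list_mult G hs"
proof (induction gs)
  case Nil
  then show ?case using list_mult_closed[of hs] by (simp add: list_mult_def)
next
  case (Cons a gs)
  then show ?case
    using list_mult_closed[of hs] list_mult_closed[of gs] by (simp add: list_mult_def m_assoc)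
qed

abbreviation "B \<equiv> pp G"

lemma pp_0 [simp]: "B g 0 = \<one>"
  by (simp add: pp_def list_mult_def)

lemma pp_closed [simp, intro]: "set g \<subseteq> carrier G \<Longrightarrow> B g k \<in> carrier G"
  unfolding pp_def using set_take_subset[of k g] by blast

lemma pp_Suc:
  assumes "set g \<subseteq> carrier G" "k < length g"
  shows "B g (Suc k) = B g k \<otimes> g ! k"
proof -
  have "set (take k g) \<subseteq> carrier G" "g ! k \<in> carrier G"
    using assms set_take_subset[of k g] nth_mem by blast+
  moreover have "list_mult G [g ! k] = g ! k"
    using calculation by (simp add: list_mult_def)
  ultimately show ?thesis
    using assms by (simp add: pp_def take_Suc_conv_app_nth list_mult_append)
qed

lemma nth_eq_pp:
  assumes "set g \<subseteq> carrier G" "k < length g"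
  shows "g ! k = inv (B g k) \<otimes> B g (Suc k)"
proof -
  have "g ! k \<in> carrier G" using assms nth_mem by blast
  then show ?thesis
    using assms by (simp add: pp_Suc inv_mult_cancel)
qed

text \<open>In the third premise \<open>b k\<close> may be taken in the carrier, because at that
  stage of the induction it is already known to equal \<open>B g k\<close>.\<close>

lemma pp_eqI:
  assumes "set g \<subseteq> carrier G" "b 0 = \<one>"
    and "\<And>k. k < length g \<Longrightarrow> b k \<in> carrier G \<Longrightarrow> b k \<otimes> g ! k = b (Suc k)"
    and "k \<le> length g"
  shows "B g k = b k"
  using assms(4)
proof (induction k)
  case 0
  then show ?case using assms by simp
next
  case (Suc k)
  then show ?case
    using assms pp_Suc[of g k] pp_closed[of g k] by simp
qed

lemma list_eq_pp:
  assumes "set g \<subseteq> carrier G" "set h \<subseteq> carrier G" "length g = length h"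
    and "\<And>k. k \<le> length g \<Longrightarrow> B g k = B h k"
  shows "g = h"
  using assms by (intro nth_equalityI) (simp_all add: nth_eq_pp)

lemma list_mult_slice:
  assumes "set g \<subseteq> carrier G" "a \<le> b" "b \<le> length g"
  shows "list_mult G (map ((!) g) [a..<b]) = inv (B g a) \<otimes> B g b"
proof -
  have "take b g = take a g @ map ((!) g) [a..<b]"
    using assms by (intro nth_equalityI) (auto simp: nth_append)
  then have "B g b = B g a \<otimes> list_mult G (map ((!) g) [a..<b])"
    unfolding pp_def using assms set_take_subset[of a g]
    by (subst list_mult_append[symmetric]) (auto dest: nth_mem)
  moreover have "list_mult G (map ((!) g) [a..<b]) \<in> carrier G"
    using assms by (intro list_mult_closed) (auto dest: nth_mem)
  ultimately show ?thesis
    using assms by (simp add: inv_mult_cancel)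
qed

definition tuple :: "nat \<Rightarrow> (nat \<Rightarrow> 'a) \<Rightarrow> 'a list" where
  "tuple n b = map (\<lambda>k. inv (b k) \<otimes> b (Suc k)) [0..<Suc n]"

lemma tuple_pp:
  assumes "b 0 = \<one>" "\<And>k. k \<le> Suc n \<Longrightarrow> b k \<in> carrier G" "k \<le> Suc n"
  shows "B (tuple n b) k = b k"
proof (rule pp_eqI)
  show "set (tuple n b) \<subseteq> carrier G"
    using assms(2) by (auto simp: tuple_def)
next
  fix k assume "k < length (tuple n b)" "b k \<in> carrier G"
  then show "b k \<otimes> tuple n b ! k = b (Suc k)"
    using assms(2) by (simp add: tuple_def mult_inv_cancel nth_append del: upt_Suc)
qed (use assms in \<open>simp_all add: tuple_def\<close>)

end

section \<open>The order on \<open>G\<close> and the powers of the central element\<close>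

locale central_interval = left_ordered_group G P for G (structure) and P :: "'g set" +
  fixes z :: 'g
  assumes z_pos: "z \<in> P"
    and z_central: "x \<in> carrier G \<Longrightarrow> z \<otimes> x = x \<otimes> z"
    and z_neq_one: "z \<noteq> \<one>"
begin

lemma pos_carrier [simp, intro]: "x \<in> P \<Longrightarrow> x \<in> carrier G"
  using pos_subset by blast

lemma z_carrier [simp, intro]: "z \<in> carrier G"
  using z_pos by blast

lemma one_pos [simp, intro]: "\<one> \<in> P"
  using pos_Int_inv by blast

lemma pos_inv_cases: "x \<in> carrier G \<Longrightarrow> x \<in> P \<or> inv x \<in> P"
  using pos_Un_inv by (auto simp: SET_INV_def)

lemma pos_antisym:
  assumes "x \<in> P" "inv x \<in> P"
  shows "x = \<one>"
proof -
  have "x \<in> set_inv P"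
    using assms inv_inv[OF pos_carrier[OF assms(1)]] by (force simp: SET_INV_def)
  then show ?thesis
    using assms pos_Int_inv by blast
qed

abbreviation le (infix "\<sqsubseteq>" 50) where "a \<sqsubseteq> b \<equiv> lo_le G P a b"

lemma le_refl [simp]: "a \<in> carrier G \<Longrightarrow> a \<sqsubseteq> a"
  by (simp add: lo_le_def)

lemma le_trans:
  assumes "a \<sqsubseteq> b" "b \<sqsubseteq> c" "a \<in> carrier G" "b \<in> carrier G" "c \<in> carrier G"
  shows "a \<sqsubseteq> c"
proof -
  have "inv a \<otimes> c = (inv a \<otimes> b) \<otimes> (inv b \<otimes> c)"
    using assms by (simp add: m_assoc mult_inv_cancel)
  then show ?thesis
    using assms pos_mult by (simp add: lo_le_def)
qed

lemma le_antisym: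
  assumes "a \<sqsubseteq> b" "b \<sqsubseteq> a" "a \<in> carrier G" "b \<in> carrier G"
  shows "a = b"
proof -
  have "inv (inv a \<otimes> b) = inv b \<otimes> a"
    using assms by (simp add: inv_mult_group)
  then have "inv a \<otimes> b = \<one>"
    using assms pos_antisym by (simp add: lo_le_def)
  then show ?thesis
    using assms mult_inv_cancel by fastforce
qed

lemma le_total:
  assumes "a \<in> carrier G" "b \<in> carrier G"
  shows "a \<sqsubseteq> b \<or> b \<sqsubseteq> a"
proof -
  have "inv (inv a \<otimes> b) = inv b \<otimes> a"
    using assms by (simp add: inv_mult_group)
  then show ?thesis
    using pos_inv_cases[of "inv a \<otimes> b"] assms by (auto simp: lo_le_def)
qed

lemma one_le_iff [simp]: "a \<in> carrier G \<Longrightarrow> \<one> \<sqsubseteq> a \<longleftrightarrow> a \<in> P"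
  by (simp add: lo_le_def)

lemma le_mult_left [simp]:
  "\<lbrakk>a \<in> carrier G; b \<in> carrier G; c \<in> carrier G\<rbrakk> \<Longrightarrow> c \<otimes> a \<sqsubseteq> c \<otimes> b \<longleftrightarrow> a \<sqsubseteq> b"
  by (simp add: lo_le_def inv_mult_cancel_left)

lemma z_pow_central:
  assumes "x \<in> carrier G"
  shows "z [^] (k::int) \<otimes> x = x \<otimes> z [^] k"
proof -
  have inv: "inv z \<otimes> x = x \<otimes> inv z"
    using assms z_central by (metis inv_closed inv_solve_left inv_solve_right m_assoc m_closed z_carrier)
  have nat: "z [^] (i::nat) \<otimes> x = x \<otimes> z [^] i" for i
    by (induction i) (use assms z_central in \<open>simp_all add: m_assoc[symmetric], metis m_assoc nat_pow_closed z_carrier\<close>)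
  have ninv: "inv (z [^] (i::nat)) \<otimes> x = x \<otimes> inv (z [^] i)" for i
    using assms nat by (metis inv_closed inv_solve_left inv_solve_right m_assoc m_closed z_carrier nat_pow_closed)
  show ?thesis
    using nat ninv by (cases k rule: int_cases2) (simp_all add: int_pow_int int_pow_neg)
qed

lemma z_pow_pos: "z [^] (i::nat) \<in> P"
  by (induction i) (simp_all add: z_pos pos_mult)

lemma z_pow_le_z_pow:
  assumes "(j::int) \<le> k"
  shows "z [^] j \<sqsubseteq> z [^] k"
proof -
  have "z [^] k = z [^] j \<otimes> z [^] (nat (k - j))"
    using assms by (simp flip: int_pow_int add: int_pow_mult[symmetric])
  then show ?thesis
    by (simp add: lo_le_def inv_mult_cancel z_pow_pos)
qed

lemma z_pow_le_iff: "z [^] (j::int) \<sqsubseteq> z [^] (k::int) \<longleftrightarrow> j \<le> k"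
proof
  assume le: "z [^] j \<sqsubseteq> z [^] k"
  show "j \<le> k"
  proof (rule ccontr)
    assume "\<not> j \<le> k"
    then have "z [^] (k + 1) \<sqsubseteq> z [^] k"
      using le z_pow_le_z_pow[of "k + 1" j] by (intro le_trans[OF _ le]) auto
    then have "z [^] k \<otimes> z \<sqsubseteq> z [^] k \<otimes> \<one>"
      by (simp add: int_pow_mult)
    then have "z \<sqsubseteq> \<one>"
      by (subst (asm) le_mult_left) auto
    then show False
      using le_antisym[of z \<one>] z_pos z_neq_one by simp
  qed
qed (rule z_pow_le_z_pow)

section \<open>Subdivisions of the interval and their periodic extension\<close>

abbreviation "F \<equiv> F_obj G P z"

lemma F_length: "g \<in> F n \<Longrightarrow> length g = Suc n"
  by (simp add: F_obj_def)

lemma F_carrier: "g \<in> F n \<Longrightarrow> set g \<subseteq> carrier G"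
  using pos_subset by (auto simp: F_obj_def)

lemma F_pp_closed [simp, intro]: "g \<in> F n \<Longrightarrow> B g k \<in> carrier G"
  using F_carrier pp_closed by blast

lemma F_nth_pos: "g \<in> F n \<Longrightarrow> k \<le> n \<Longrightarrow> g ! k \<in> P"
  by (auto simp: F_obj_def)

lemma F_pp_end: "g \<in> F n \<Longrightarrow> B g (Suc n) = z"
  by (simp add: F_obj_def pp_def)

lemma F_I:
  assumes "length g = Suc n" "set g \<subseteq> carrier G" "B g (Suc n) = z"
    and "\<And>k. k \<le> n \<Longrightarrow> inv (B g k) \<otimes> B g (Suc k) \<in> P"
  shows "g \<in> F n"
proof -
  have "g ! k \<in> P" if "k < length g" for k
    using assms that nth_eq_pp[of g k] by simp
  then show ?thesis
    using assms(1,3) by (auto simp: F_obj_def pp_def in_set_conv_nth)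
qed

lemma tuple_in_F:
  assumes "b 0 = \<one>" "b (Suc n) = z" "\<And>k. k \<le> Suc n \<Longrightarrow> b k \<in> carrier G"
    and "\<And>k. k \<le> n \<Longrightarrow> b k \<sqsubseteq> b (Suc k)"
  shows "tuple n b \<in> F n"
proof (rule F_I)
  show "set (tuple n b) \<subseteq> carrier G"
    using assms(3) by (auto simp: tuple_def)
qed (use assms in \<open>simp_all add: tuple_pp lo_le_def\<close>, simp add: tuple_def)

text \<open>With vertices at all integers, rotation is a mere change of base point and needs no case
  distinction at the end of the tuple. The quotient by \<open>length g\<close>, which is n + 1 on
  \<open>F n\<close>, counts the factors \<open>z\<close>.\<close>

definition bt :: "'g list \<Rightarrow> int \<Rightarrow> 'g" where
  "bt g k = z [^] (k div int (length g)) \<otimes> B g (nat (k mod int (length g)))"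

lemma bt_closed [simp, intro]: "g \<in> F n \<Longrightarrow> bt g k \<in> carrier G"
  unfolding bt_def by (intro m_closed int_pow_closed) auto

lemma bt_of_nat:
  assumes g: "g \<in> F n" and "k \<le> Suc n"
  shows "bt g (int k) = B g k"
proof (cases "k = Suc n")
  \<comment> \<open>At the end point the remainder is 0 and the quotient is 1, so the value
    \<open>z\<close> comes from the power and not from the partial product.\<close>
  case True
  then show ?thesis
    using g by (simp add: bt_def F_length F_pp_end)
next
  case False
  then show ?thesis
    using g assms(2) by (simp add: bt_def F_length)
qed

lemma bt_0 [simp]: "g \<in> F n \<Longrightarrow> bt g 0 = \<one>"
  using bt_of_nat[of g n 0] by simp

lemma bt_shift:
  assumes g: "g \<in> F n"
  shows "bt g (k + q * (int n + 1)) = z [^] q \<otimes> bt g k"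
proof -
  have "(k + q * (int n + 1)) mod (int n + 1) = k mod (int n + 1)"
    "(k + q * (int n + 1)) div (int n + 1) = q + k div (int n + 1)"
    by (rule mod_mult_self1, rule div_mult_self1) simp
  then show ?thesis
    using g by (simp add: bt_def F_length add.commute[of 1] int_pow_mult m_assoc)
qed

lemma bt_Suc:
  assumes g: "g \<in> F n"
  shows "bt g (k + 1) = bt g k \<otimes> g ! nat (k mod (int n + 1))"
proof -
  define r q where "r = nat (k mod (int n + 1))" and "q = k div (int n + 1)"
  have r: "int r = k mod (int n + 1)" by (simp add: r_def)
  then have k: "k = int r + q * (int n + 1)" by (simp add: q_def mod_div_mult_eq)
  have "r < Suc n"
    using r pos_mod_bound[of "int n + 1" k] by linarith
  then have "bt g (int (Suc r)) = bt g (int r) \<otimes> g ! r"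
    using g by (simp only: bt_of_nat) (simp add: pp_Suc F_carrier F_length bt_of_nat)
  then have "bt g (int r + 1) = bt g (int r) \<otimes> g ! r"
    by (simp add: add.commute)
  moreover have "k + 1 = (int r + 1) + q * (int n + 1)"
    by (simp add: k)
  moreover have "g ! r \<in> carrier G"
    using F_nth_pos[OF g, of r] \<open>r < Suc n\<close> by simp
  moreover have "bt g k = z [^] q \<otimes> bt g (int r)"
    by (subst k) (rule bt_shift[OF g])
  ultimately show ?thesis
    using g by (simp only: bt_shift[OF g] r_def[symmetric]) (simp add: m_assoc)
qed

lemma bt_mono:
  assumes g: "g \<in> F n" and "j \<le> k"
  shows "bt g j \<sqsubseteq> bt g k"
  using \<open>j \<le> k\<close>
proof (induction k rule: int_ge_induct)
  case base
  then show ?case using g by simp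
next
  case (step k)
  have "nat (k mod (int n + 1)) \<le> n"
    using pos_mod_bound[of "int n + 1" k] by linarith
  then have "g ! nat (k mod (int n + 1)) \<in> P"
    by (rule F_nth_pos[OF g])
  then have "bt g k \<sqsubseteq> bt g (k + 1)"
    using g by (simp add: bt_Suc lo_le_def inv_mult_cancel)
  then show ?case
    using g step by (blast intro: le_trans)
qed

lemma pp_mono: "\<lbrakk>g \<in> F n; j \<le> k; k \<le> Suc n\<rbrakk> \<Longrightarrow> B g j \<sqsubseteq> B g k"
  using bt_mono[of g n "int j" "int k"] by (simp add: bt_of_nat)

lemma pp_pos: "g \<in> F n \<Longrightarrow> k \<le> Suc n \<Longrightarrow> B g k \<in> P"
  using pp_mono[of g n 0 k] by simp

lemma pp_le_z: "g \<in> F n \<Longrightarrow> k \<le> Suc n \<Longrightarrow> B g k \<sqsubseteq> z"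
  using pp_mono[of g n k "Suc n"] by (simp add: F_pp_end)

text \<open>Rotating makes the vertex \<open>a\<close> of the periodic chain the new origin. The
  wrap-around is absorbed by \<open>bt\<close>, so \<open>a\<close> may be any natural
  number.\<close>

lemma rotate_pp:
  assumes g: "g \<in> F n" and k: "k \<le> Suc n"
  shows "B (rotate a g) k = inv (bt g (int a)) \<otimes> bt g (int a + int k)"
proof (rule pp_eqI)
  fix k assume k: "k < length (rotate a g)"
  have "nat ((int a + int k) mod (int n + 1)) = (a + k) mod Suc n"
    by (simp add: nat_mod_distrib nat_add_distrib add.commute[of _ 1] flip: of_nat_add of_nat_Suc)
  then show "inv (bt g (int a)) \<otimes> bt g (int a + int k) \<otimes> rotate a g ! k
      = inv (bt g (int a)) \<otimes> bt g (int a + int (Suc k))"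
    using bt_Suc[OF g, of "int a + int k"] k g F_nth_pos[OF g, of "(a + k) mod Suc n"]
    by (simp add: nth_rotate F_length m_assoc add.assoc add.commute[of 1] less_Suc_eq_le[symmetric])
qed (use assms F_carrier[OF g] F_length[OF g] in simp_all)

lemma rotate_in_F:
  assumes g: "g \<in> F n"
  shows "rotate a g \<in> F n"
proof (rule F_I)
  \<comment> \<open>Centrality enters here: the new end vertex is a conjugate of \<open>z\<close>,
    hence \<open>z\<close> itself.\<close>
  have "bt g (int a + int (Suc n)) = bt g (int a) \<otimes> z"
    using bt_shift[OF g, of "int a" 1] g by (simp add: add.assoc add.commute[of 1] z_central)
  then show "B (rotate a g) (Suc n) = z"
    using g by (simp only: rotate_pp[OF g]) (simp add: inv_mult_cancel)
next
  fix k assume "k \<le> n"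
  then show "inv (B (rotate a g) k) \<otimes> B (rotate a g) (Suc k) \<in> P"
    using g bt_mono[OF g, of "int a + int k" "int a + int (Suc k)"]
    by (simp add: rotate_pp[OF g] lo_le_def inv_mult_cancel_left del: of_nat_Suc)
qed (use F_carrier[OF g] F_length[OF g] in simp_all)

lemma rotate_bt:
  assumes g: "g \<in> F n"
  shows "bt (rotate a g) k = inv (bt g (int a)) \<otimes> bt g (int a + k)"
proof -
  define r q where "r = nat (k mod (int n + 1))" and "q = k div (int n + 1)"
  have r: "int r = k mod (int n + 1)" by (simp add: r_def)
  then have k: "k = int r + q * (int n + 1)" by (simp add: q_def mod_div_mult_eq)
  have "r \<le> Suc n"
    using r pos_mod_bound[of "int n + 1" k] by linarith
  have "bt (rotate a g) k = z [^] q \<otimes> (inv (bt g (int a)) \<otimes> bt g (int a + int r))"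
    using \<open>r \<le> Suc n\<close>
    by (simp only: k bt_shift[OF rotate_in_F[OF g]] bt_of_nat[OF rotate_in_F[OF g]] rotate_pp[OF g])
  also have "\<dots> = inv (bt g (int a)) \<otimes> (z [^] q \<otimes> bt g (int a + int r))"
    using g z_pow_central[of "inv (bt g (int a))" q] by (simp add: m_assoc[symmetric])
  also have "z [^] q \<otimes> bt g (int a + int r) = bt g (int a + k)"
    using bt_shift[OF g, of "int a + int r" q] by (simp add: k add.assoc)
  finally show ?thesis .
qed

section \<open>Push-forward of subdivisions along simplicial maps\<close>

lemma F_Delta_pp:
  assumes \<phi>: "\<phi> \<in> Delta_hom m n" and g: "g \<in> F m"
    and l: "l \<le> Suc n" and c: "c \<le> Suc m" and cut: "\<And>i. i \<le> m \<Longrightarrow> \<phi> i < l \<longleftrightarrow> i < c"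
  shows "B (F_Delta G m n \<phi> g) l = B g c"
proof -
  \<comment> \<open>Cuts are chosen for all levels at once, since an entry of the image involves the
    cuts at two consecutive levels.\<close>
  define cc where "cc l = (SOME c. c \<le> Suc m \<and> (\<forall>i\<le>m. \<phi> i < l \<longleftrightarrow> i < c))" for l
  have cc: "cc l \<le> Suc m \<and> (\<forall>i\<le>m. \<phi> i < l \<longleftrightarrow> i < cc l)" for l
    unfolding cc_def
    by (rule someI_ex) (metis Delta_cut_exists[OF \<phi>])
  have cc_eq: "cc l = c" if "c \<le> Suc m" "\<And>i. i \<le> m \<Longrightarrow> \<phi> i < l \<longleftrightarrow> i < c" for l c
  proof (rule cut_unique[of _ m])
    fix i assume "i \<le> m"
    then show "i < cc l \<longleftrightarrow> i < c" using cc[of l] that(2)[of i] by auto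
  qed (use cc that in auto)
  note gc = F_carrier[OF g]
  \<comment> \<open>The fibre over \<open>l\<close> is the slice between consecutive cuts, so the
    product of its entries telescopes to a quotient of two vertices.\<close>
  have nth: "F_Delta G m n \<phi> g ! l = inv (B g (cc l)) \<otimes> B g (cc (Suc l))" if "l < Suc n" for l
  proof -
    have "cc l \<le> cc (Suc l)"
    proof (rule cut_mono[of _ m])
      fix i assume "i \<le> m" "i < cc l"
      then have "\<phi> i < Suc l" using cc[of l] by (blast intro: less_SucI)
      then show "i < cc (Suc l)" using cc[of "Suc l"] \<open>i \<le> m\<close> by blast
    qed (use cc in auto)
    moreover have "\<phi> i = l \<longleftrightarrow> cc l \<le> i \<and> i < cc (Suc l)" if "i < Suc m" for i
    proof -
      have "\<phi> i < l \<longleftrightarrow> i < cc l" "\<phi> i < Suc l \<longleftrightarrow> i < cc (Suc l)"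
        using cc[of l] cc[of "Suc l"] that by auto
      then show ?thesis by linarith
    qed
    ultimately have "filter (\<lambda>i. \<phi> i = l) [0..<Suc m] = [cc l..<cc (Suc l)]"
      using cc by (intro filter_upt_slice) blast+
    then show ?thesis
      using that cc list_mult_slice[OF gc \<open>cc l \<le> cc (Suc l)\<close>] F_length[OF g]
      by (simp add: F_Delta_def del: upt_Suc)
  qed
  have sub: "set (F_Delta G m n \<phi> g) \<subseteq> carrier G"
  proof
    fix y assume "y \<in> set (F_Delta G m n \<phi> g)"
    then obtain l where "l < Suc n" "y = F_Delta G m n \<phi> g ! l"
      by (auto simp: in_set_conv_nth F_Delta_def simp del: upt_Suc)
    then show "y \<in> carrier G" using nth g by simp
  qed
  have "B (F_Delta G m n \<phi> g) l = B g (cc l)"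
  proof (rule pp_eqI[OF sub])
    show "B g (cc 0) = \<one>" using cc_eq[of 0 0] by simp
  next
    fix k assume "k < length (F_Delta G m n \<phi> g)"
    then show "B g (cc k) \<otimes> F_Delta G m n \<phi> g ! k = B g (cc (Suc k))"
      using nth[of k] g by (simp add: F_Delta_def mult_inv_cancel del: upt_Suc)
  qed (use l in \<open>simp add: F_Delta_def\<close>)
  then show ?thesis
    using cc_eq[OF c cut] by simp
qed

lemma F_Delta_in_F:
  assumes \<phi>: "\<phi> \<in> Delta_hom m n" and g: "g \<in> F m"
  shows "F_Delta G m n \<phi> g \<in> F n"
proof (rule F_I)
  show len: "length (F_Delta G m n \<phi> g) = Suc n"
    by (simp add: F_Delta_def)
  show "set (F_Delta G m n \<phi> g) \<subseteq> carrier G"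
    using F_carrier[OF g]
    by (auto simp: F_Delta_def simp del: upt_Suc intro!: list_mult_closed dest!: subsetD[OF F_carrier[OF g]] nth_mem)
       (use F_carrier[OF g] F_length[OF g] in \<open>auto dest!: nth_mem\<close>)
  show "B (F_Delta G m n \<phi> g) (Suc n) = z"
    using Delta_hom_le[OF \<phi>] by (subst F_Delta_pp[OF \<phi> g, of _ "Suc m"]) (auto simp: F_pp_end[OF g] le_imp_less_Suc)
next
  fix k assume "k \<le> n"
  obtain c where c: "c \<le> Suc m" "\<And>i. i \<le> m \<Longrightarrow> \<phi> i < k \<longleftrightarrow> i < c"
    using Delta_cut_exists[OF \<phi>] by blast
  obtain d where d: "d \<le> Suc m" "\<And>i. i \<le> m \<Longrightarrow> \<phi> i < Suc k \<longleftrightarrow> i < d"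
    using Delta_cut_exists[OF \<phi>] by blast
  have "c \<le> d"
  proof (rule cut_mono[of _ m])
    fix i assume "i \<le> m" "i < c"
    then show "i < d" using c(2)[of i] d(2)[of i] by auto
  qed (rule c(1))
  then show "inv (B (F_Delta G m n \<phi> g) k) \<otimes> B (F_Delta G m n \<phi> g) (Suc k) \<in> P"
    using F_Delta_pp[OF \<phi> g _ c] F_Delta_pp[OF \<phi> g _ d] \<open>k \<le> n\<close> pp_mono[OF g _ d(1)]
    by (simp add: lo_le_def)
qed

text \<open>The end vertices are always the unit and \<open>z\<close>, so only interior vertices
  have to be compared.\<close>

lemma F_Delta_eqI:
  assumes \<phi>: "\<phi> \<in> Delta_hom m n" and g: "g \<in> F m" and g': "g' \<in> F n"
    and eq: "\<And>l c. \<lbrakk>0 < l; l \<le> n; c \<le> Suc m; \<And>i. i \<le> m \<Longrightarrow> \<phi> i < l \<longleftrightarrow> i < c\<rbrakk> \<Longrightarrow> B g' l = B g c"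
  shows "F_Delta G m n \<phi> g = g'"
proof (rule list_eq_pp)
  note Fg = F_Delta_in_F[OF \<phi> g]
  show "set (F_Delta G m n \<phi> g) \<subseteq> carrier G" "set g' \<subseteq> carrier G"
    "length (F_Delta G m n \<phi> g) = length g'"
    using F_carrier[OF g'] F_carrier[OF Fg] F_length[OF g'] F_length[OF Fg] by auto
  fix l assume "l \<le> length (F_Delta G m n \<phi> g)"
  then consider "l = 0" | "l = Suc n" | "0 < l" "l \<le> n"
    using F_length[OF Fg] by linarith
  then show "B (F_Delta G m n \<phi> g) l = B g' l"
  proof cases
    case 3
    obtain c where "c \<le> Suc m" "\<And>i. i \<le> m \<Longrightarrow> \<phi> i < l \<longleftrightarrow> i < c"
      using Delta_cut_exists[OF \<phi>] by blast
    then show ?thesis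
      using 3 eq[of l c] F_Delta_pp[OF \<phi> g, of l c] by simp
  qed (simp_all add: F_pp_end[OF Fg] F_pp_end[OF g'])
qed

lemma F_Delta_bt:
  assumes \<phi>: "\<phi> \<in> Delta_hom m n" and g: "g \<in> F m"
    and cut: "\<And>x. periodic_ext m n \<phi> x < l \<longleftrightarrow> x < c"
  shows "bt (F_Delta G m n \<phi> g) l = bt g c"
proof -
  define r q where "r = nat (l mod (int n + 1))" and "q = l div (int n + 1)"
  have r: "int r = l mod (int n + 1)" by (simp add: r_def)
  then have l: "l = int r + q * (int n + 1)" by (simp add: q_def mod_div_mult_eq)
  have "r \<le> Suc n"
    using r pos_mod_bound[of "int n + 1" l] by linarith
  obtain d where d: "d \<le> Suc m" "\<And>i. i \<le> m \<Longrightarrow> \<phi> i < r \<longleftrightarrow> i < d"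
    using Delta_cut_exists[OF \<phi>] by blast
  have "x < c \<longleftrightarrow> x < int d + q * (int m + 1)" for x
    using periodic_ext_cut_shift[OF periodic_ext_cut[OF \<phi> \<open>r \<le> Suc n\<close> d], of x q] cut[of x]
    by (simp add: l)
  then have c: "c = int d + q * (int m + 1)"
    by (meson linorder_neqE order_less_irrefl)
  show ?thesis
    using F_Delta_pp[OF \<phi> g \<open>r \<le> Suc n\<close> d] \<open>r \<le> Suc n\<close> d(1) g F_Delta_in_F[OF \<phi> g]
    by (simp add: l c bt_shift bt_of_nat)
qed

lemma F_Delta_id:
  assumes g: "g \<in> F n"
  shows "F_Delta G n n (Delta_id n) g = g"
proof (rule F_Delta_eqI[OF Delta_id_in_Delta_hom g g])
  fix l c assume l: "0 < l" "l \<le> n" "c \<le> Suc n" and *: "\<And>i. i \<le> n \<Longrightarrow> Delta_id n i < l \<longleftrightarrow> i < c"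
  have "\<not> l < c" "l - 1 < c"
    using *[of l] *[of "l - 1"] l by (auto simp: Delta_id_def)
  then have "c = l" by linarith
  then show "B g l = B g c" by simp
qed

text \<open>\<open>F_aut\<close> reads off the exponent between 0 and n. Any other exponent differs
  from it by a multiple of n + 1, the length of the list, and so gives the same rotation.\<close>

lemma F_Lam_rot:
  assumes g: "g \<in> F n"
  shows "F_Lam G n n (rot n (- int a)) g = rotate a g"
proof -
  obtain b where b: "b \<le> n" "rot n (- int a) = rot n (- int b)"
    using Lam_aut_cases[OF rot_in_Lam_aut] by metis
  then have "(int n + 1) dvd int b - int a"
    by (simp add: rot_eq_iff)
  then have "a mod Suc n = b mod Suc n"
    by (metis mod_eq_dvd_iff of_nat_eq_iff of_nat_mod of_nat_Suc add.commute)
  then have "rotate a g = rotate b g"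
    using rotate_conv_mod[of a g] rotate_conv_mod[of b g] F_length[OF g] by simp
  moreover have "(THE a. a \<le> n \<and> rot n (- int b) = tau_pow n a) = b"
    using b(1) rot_neg_inj by (intro the_equality) (auto simp: tau_pow_rot)
  ultimately show ?thesis
    by (simp add: F_Lam_def b(2) delta_part_rot aut_part_rot F_aut_def F_Delta_id rotate_in_F[OF g])
qed

end

section \<open>Realizations\<close>

text \<open>The closure property that keeps both sides of a gluing step among the admissible pairs.
  It covers cyclic sets by definition and \<open>C_cyc\<close> by the explicit formula for its
  action.\<close>

definition Delta_closed :: "'s cyclic \<Rightarrow> bool" where
  "Delta_closed S \<longleftrightarrow>
    (\<forall>m n. \<forall>\<phi> \<in> Delta_hom m n. \<forall>x \<in> obj S n. act S m n x (Delta_to_Lam m n \<phi>) \<in> obj S m)"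

lemma Delta_closed_cyclic: "cyclic_set S \<Longrightarrow> Delta_closed S"
  by (simp add: cyclic_set_def Delta_closed_def Delta_to_Lam_in_Lam_hom)

lemma obj_C: "obj C_cyc n = Lam_aut n"
  by (simp add: C_cyc_def)

lemma act_C: "act C_cyc m n \<gamma> \<phi> = aut_part m n (\<gamma> \<odot> \<phi>)"
  by (simp add: C_cyc_def)

lemma Delta_closed_C: "Delta_closed C_cyc"
  unfolding Delta_closed_def obj_C act_C
proof (intro allI ballI)
  fix m n \<phi> \<gamma> assume \<phi>: "\<phi> \<in> Delta_hom m n" and "\<gamma> \<in> Lam_aut n"
  then obtain a where "\<gamma> = rot n (- int a)" by (blast elim: Lam_aut_cases)
  moreover obtain b where "\<And>x. periodic_ext m n \<phi> x < int a \<longleftrightarrow> x < b"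
    using periodic_ext_cut_exists[OF \<phi>] by blast
  ultimately show "aut_part m n (\<gamma> \<odot> Delta_to_Lam m n \<phi>) \<in> Lam_aut m"
    by (simp add: aut_part_rot_Delta[OF \<phi>] rot_in_Lam_aut)
qed

context central_interval
begin

abbreviation "cls \<equiv> cyc_class G P z"
abbreviation "glueS S \<equiv> glue_equiv G P z (underlying_simplicial S)"
abbreviation "real S \<equiv> cyc_realization G P z S"

lemma equiv_glue: "equiv (pre_points G P z (underlying_simplicial S)) (glueS S)"
  by (rule equivI)
    (auto simp: glue_equiv_def refl_on_def sym_def trans_def intro: equivclp_sym equivclp_trans)

lemma pre_points_iff:
  "(n, x, g) \<in> pre_points G P z (underlying_simplicial S) \<longleftrightarrow> x \<in> obj S n \<and> g \<in> F n"
  by (simp add: pre_points_def underlying_simplicial_def)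

lemma cls_in_real [intro]: "x \<in> obj S n \<Longrightarrow> g \<in> F n \<Longrightarrow> cls S n x g \<in> real S"
  unfolding cyc_realization_def realization_def cyc_class_def
  by (intro quotientI) (simp add: pre_points_iff)

lemma real_cases:
  assumes "X \<in> real S"
  obtains n x g where "x \<in> obj S n" "g \<in> F n" "X = cls S n x g"
proof -
  obtain u where u: "u \<in> pre_points G P z (underlying_simplicial S)" "X = glueS S `` {u}"
    using assms unfolding cyc_realization_def realization_def by (blast elim: quotientE)
  obtain n x g where "u = (n, x, g)" by (cases u)
  with u show ?thesis
    by (intro that[of x n g]) (auto simp: pre_points_iff cyc_class_def)
qed

lemma cls_glue:
  assumes S: "Delta_closed S" and \<phi>: "\<phi> \<in> Delta_hom m n" and x: "x \<in> obj S n" and g: "g \<in> F m"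
  shows "cls S m (act S m n x (Delta_to_Lam m n \<phi>)) g = cls S n x (F_Delta G m n \<phi> g)"
  unfolding cyc_class_def
proof (rule equiv_class_eq[OF equiv_glue])
  have "glue G P z (underlying_simplicial S) (m, act S m n x (Delta_to_Lam m n \<phi>), g) (n, x, F_Delta G m n \<phi> g)"
    using glue.glueI[of \<phi> m n x "underlying_simplicial S" g G P z] \<phi> x g
    by (simp add: underlying_simplicial_def)
  then show "((m, act S m n x (Delta_to_Lam m n \<phi>), g), (n, x, F_Delta G m n \<phi> g)) \<in> glueS S"
    using S \<phi> x g F_Delta_in_F[OF \<phi> g]
    by (auto simp: glue_equiv_def pre_points_iff Delta_closed_def)
qed

text \<open>Descent to classes: a function invariant under one gluing step is constant along the
  generated equivalence, so its image of a class is a singleton.\<close>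

lemma lift_cls:
  assumes S: "Delta_closed S" and x: "x \<in> obj S n" and g: "g \<in> F n"
    and K: "\<And>m n \<phi> x g. \<lbrakk>\<phi> \<in> Delta_hom m n; x \<in> obj S n; g \<in> F m\<rbrakk> \<Longrightarrow>
      K (m, act S m n x (Delta_to_Lam m n \<phi>), g) = K (n, x, F_Delta G m n \<phi> g)"
  shows "the_elem (K ` cls S n x g) = K (n, x, g)"
proof (rule the_elem_image_unique)
  show "cls S n x g \<noteq> {}"
    unfolding cyc_class_def using equiv_class_self[OF equiv_glue, of "(n, x, g)" S] x g
    by (auto simp: pre_points_iff)
next
  have step: "K u = K v" if "glue G P z (underlying_simplicial S) u v" for u v
    using that by cases (auto simp: underlying_simplicial_def K)
  fix v assume "v \<in> cls S n x g"
  then have "equivclp (glue G P z (underlying_simplicial S)) (n, x, g) v"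
    by (auto simp: cyc_class_def glue_equiv_def)
  then show "K v = K (n, x, g)"
    by induction (auto dest: step)
qed

section \<open>Cosets of the powers of z\<close>

abbreviation "coset h \<equiv> int_powers G z #> h"

lemma coset_eq_iff:
  assumes "h \<in> carrier G" "h' \<in> carrier G"
  shows "coset h = coset h' \<longleftrightarrow> (\<exists>k::int. h = z [^] k \<otimes> h')"
proof
  assume eq: "coset h = coset h'"
  have "z [^] (0::int) \<otimes> h \<in> coset h"
    unfolding r_coset_def int_powers_def by blast
  then have "h \<in> coset h'"
    using assms by (simp add: eq)
  then show "\<exists>k::int. h = z [^] k \<otimes> h'"
    unfolding r_coset_def int_powers_def by blast
next
  assume "\<exists>k::int. h = z [^] k \<otimes> h'"
  then obtain k :: int where k: "h = z [^] k \<otimes> h'" by blast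
  have "z [^] (j::int) \<otimes> h = z [^] (j + k) \<otimes> h'" for j
    using assms by (simp add: k m_assoc int_pow_mult)
  moreover have "z [^] (j::int) \<otimes> h' = z [^] (j - k) \<otimes> h" for j
    using assms by (simp add: k m_assoc[symmetric] int_pow_mult[symmetric])
  ultimately show "coset h = coset h'"
    unfolding r_coset_def int_powers_def by blast
qed

text \<open>The chain z \<le> z^k \<le> z^k h' = h \<le> z consists of equalities, which gives k = 1
  and then h' = 1.\<close>

lemma mult_z_pow_in_interval:
  assumes "h \<in> P" "h' \<in> P" "h \<sqsubseteq> z" "1 \<le> k" "h = z [^] (k::int) \<otimes> h'"
  shows "h = z \<and> h' = \<one>"
proof -
  have c [simp]: "h \<in> carrier G" "h' \<in> carrier G" using assms by auto
  have "z [^] k \<otimes> \<one> \<sqsubseteq> z [^] k \<otimes> h'"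
    using assms(2) by (subst le_mult_left) auto
  then have kh: "z [^] k \<sqsubseteq> h"
    using assms(5) by simp
  have "z [^] (1::int) \<sqsubseteq> z [^] k"
    using assms(4) by (rule z_pow_le_z_pow)
  then have "z \<sqsubseteq> h"
    using kh by (auto intro: le_trans)
  then have h: "h = z"
    using assms(3) by (intro le_antisym) auto
  then have "z [^] k \<sqsubseteq> z [^] (1::int)"
    using kh by simp
  then have "k = 1"
    using assms(4) z_pow_le_iff[of k 1] by simp
  then have "z \<otimes> h' = z \<otimes> \<one>"
    using assms(5) h by simp
  then show ?thesis
    using h by simp
qed

text \<open>In the quotient the interval from 1 to z becomes a circle: only its two end points are
  identified. A negative exponent reduces to a positive one by exchanging the two elements.\<close>

lemma coset_eq_in_interval:
  assumes "h \<in> P" "h' \<in> P" "h \<sqsubseteq> z" "h' \<sqsubseteq> z" "coset h = coset h'"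
  shows "h = h' \<or> h = z \<and> h' = \<one> \<or> h = \<one> \<and> h' = z"
proof -
  obtain k :: int where k: "h = z [^] k \<otimes> h'"
    using assms by (auto simp: coset_eq_iff)
  then have k': "h' = z [^] (- k) \<otimes> h"
    using assms by (simp add: m_assoc[symmetric] int_pow_mult[symmetric])
  consider "k = 0" | "1 \<le> k" | "1 \<le> - k" by linarith
  then show ?thesis
  proof cases
    case 1 then show ?thesis using k assms by simp
  next
    case 2 then show ?thesis using mult_z_pow_in_interval[OF assms(1,2,3) _ k] by blast
  next
    case 3 then show ?thesis using mult_z_pow_in_interval[OF assms(2,1,4) _ k'] by blast
  qed
qed

abbreviation "G' \<equiv> bounded_part G P z"

text \<open>Independent integer exponents on the two sides are easier to combine than a symmetric
  bound; conversely the larger absolute value serves on both sides.\<close>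

lemma bounded_part_iff:
  "g \<in> G' \<longleftrightarrow> g \<in> carrier G \<and> (\<exists>(j::int) (k::int). z [^] j \<sqsubseteq> g \<and> g \<sqsubseteq> z [^] k)"
proof
  assume "g \<in> G'"
  then show "g \<in> carrier G \<and> (\<exists>(j::int) (k::int). z [^] j \<sqsubseteq> g \<and> g \<sqsubseteq> z [^] k)"
    unfolding bounded_part_def by (auto simp: int_pow_int[symmetric] simp del: int_pow_int)
next
  assume "g \<in> carrier G \<and> (\<exists>(j::int) (k::int). z [^] j \<sqsubseteq> g \<and> g \<sqsubseteq> z [^] k)"
  then obtain j k :: int where g: "g \<in> carrier G" and j: "z [^] j \<sqsubseteq> g" and k: "g \<sqsubseteq> z [^] k"
    by blast
  define n where "n = nat (max \<bar>j\<bar> \<bar>k\<bar>)"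
  have "z [^] (- int n) \<sqsubseteq> g"
    using g by (intro le_trans[OF z_pow_le_z_pow j]) (auto simp: n_def)
  moreover have "g \<sqsubseteq> z [^] int n"
    using g by (intro le_trans[OF k z_pow_le_z_pow]) (auto simp: n_def)
  ultimately show "g \<in> G'"
    using g by (auto simp: bounded_part_def int_pow_int)
qed

lemma bounded_part_subgroup: "subgroup G' G"
proof (rule subgroupI)
  show "G' \<subseteq> carrier G" by (auto simp: bounded_part_def)
next
  have "\<one> \<in> G'"
    using z_pow_le_z_pow[of 0 0] by (auto simp: bounded_part_iff intro: exI[of _ 0])
  then show "G' \<noteq> {}" by blast
next
  fix g assume "g \<in> G'"
  then obtain j k :: int where g: "g \<in> carrier G" and j: "z [^] j \<sqsubseteq> g" and k: "g \<sqsubseteq> z [^] k"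
    by (auto simp: bounded_part_iff)
  \<comment> \<open>Only left translations preserve the order. Left multiplication by
    \<open>z [^] i \<otimes> inv g\<close> turns bounds on \<open>g\<close> into bounds on its
    inverse.\<close>
  have *: "(z [^] i \<otimes> inv g) \<otimes> g = z [^] i" "(z [^] i \<otimes> inv g) \<otimes> z [^] l = z [^] (i + l) \<otimes> inv g"
    for i l :: int
    using g z_pow_central[of "inv g" l] by (simp_all add: m_assoc int_pow_mult)
  have "(z [^] (- k) \<otimes> inv g) \<otimes> g \<sqsubseteq> (z [^] (- k) \<otimes> inv g) \<otimes> z [^] k"
    "(z [^] (- j) \<otimes> inv g) \<otimes> z [^] j \<sqsubseteq> (z [^] (- j) \<otimes> inv g) \<otimes> g"
    using g j k by (subst le_mult_left; simp)+
  then have "z [^] (- k) \<sqsubseteq> inv g" "inv g \<sqsubseteq> z [^] (- j)"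
    using g by (simp_all only: *) simp_all
  then show "inv g \<in> G'"
    using g bounded_part_iff inv_closed by blast
next
  fix g h assume "g \<in> G'" "h \<in> G'"
  then obtain j k j' k' :: int where g: "g \<in> carrier G" "z [^] j \<sqsubseteq> g" "g \<sqsubseteq> z [^] k"
    and h: "h \<in> carrier G" "z [^] j' \<sqsubseteq> h" "h \<sqsubseteq> z [^] k'"
    by (auto simp: bounded_part_iff)
  \<comment> \<open>Left multiplication by \<open>g\<close> bounds the product by \<open>g\<close>
    times powers of \<open>z\<close>; since these powers are central they can stand on the left,
    where the bounds on \<open>g\<close> apply.\<close>
  have "z [^] j' \<otimes> z [^] j \<sqsubseteq> z [^] j' \<otimes> g" "z [^] k' \<otimes> g \<sqsubseteq> z [^] k' \<otimes> z [^] k"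
    "g \<otimes> z [^] j' \<sqsubseteq> g \<otimes> h" "g \<otimes> h \<sqsubseteq> g \<otimes> z [^] k'"
    using g h by simp_all
  then have "z [^] (j' + j) \<sqsubseteq> g \<otimes> h" "g \<otimes> h \<sqsubseteq> z [^] (k' + k)"
    using g h le_trans[of "z [^] j' \<otimes> z [^] j" "g \<otimes> z [^] j'" "g \<otimes> h"]
      le_trans[of "g \<otimes> h" "g \<otimes> z [^] k'" "z [^] k' \<otimes> z [^] k"]
    by (simp_all add: z_pow_central[OF g(1)] int_pow_mult)
  then show "g \<otimes> h \<in> G'"
    using g h bounded_part_iff m_closed by blast
qed

abbreviation "H \<equiv> G\<lparr>carrier := G'\<rparr>"
abbreviation "Q \<equiv> H Mod int_powers G z"

lemma group_H: "group H"
  by (rule subgroup.subgroup_is_group[OF bounded_part_subgroup is_group])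

lemma z_pow_bounded: "z [^] (k::int) \<in> G'"
  by (subst bounded_part_iff) (blast intro: z_pow_le_z_pow)

lemma coset_H: "int_powers G z #>\<^bsub>H\<^esub> h = coset h"
  by (simp add: r_coset_def)

lemma int_powers_normal: "int_powers G z \<lhd> H"
proof (rule group.normalI[OF group_H])
  have "subgroup (int_powers G z) G"
  proof (rule subgroupI)
    fix a b assume "a \<in> int_powers G z" "b \<in> int_powers G z"
    then obtain i j :: int where "a = z [^] i" "b = z [^] j" by (auto simp: int_powers_def)
    then have "inv a = z [^] (- i)" "a \<otimes> b = z [^] (i + j)"
      by (simp_all add: int_pow_neg int_pow_mult)
    then show "inv a \<in> int_powers G z" "a \<otimes> b \<in> int_powers G z"
      unfolding int_powers_def by blast+
  qed (auto simp: int_powers_def)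
  then show "subgroup (int_powers G z) H"
    using z_pow_bounded by (intro subgroup_incl bounded_part_subgroup) (auto simp: int_powers_def)
next
  have "z [^] (k::int) \<otimes> x = x \<otimes> z [^] k" if "x \<in> G'" for x k
    using that by (intro z_pow_central) (auto simp: bounded_part_def)
  then show "\<forall>x\<in>carrier H. int_powers G z #>\<^bsub>H\<^esub> x = x <#\<^bsub>H\<^esub> int_powers G z"
    by (simp add: r_coset_def l_coset_def int_powers_def)
qed

lemma group_Q: "group Q"
  by (rule normal.factorgroup_is_group[OF int_powers_normal])

lemma coset_mult: "a \<in> G' \<Longrightarrow> b \<in> G' \<Longrightarrow> coset a \<otimes>\<^bsub>Q\<^esub> coset b = coset (a \<otimes> b)"
  using normal.rcos_sum[OF int_powers_normal, of a b] by (simp add: FactGroup_def coset_H)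

lemma carrier_Q: "carrier Q = coset ` G'"
  by (auto simp: FactGroup_def RCOSETS_def coset_H)

lemma coset_in_Q: "h \<in> G' \<Longrightarrow> coset h \<in> carrier Q"
  by (simp add: carrier_Q)

lemma bounded_part_decomp:
  assumes "g \<in> G'"
  obtains k :: int and h where "g = z [^] k \<otimes> h" "h \<in> P" "h \<sqsubseteq> z" "h \<noteq> z"
proof -
  obtain i j :: int where g: "g \<in> carrier G" and i: "z [^] i \<sqsubseteq> g" and j: "g \<sqsubseteq> z [^] j"
    using assms by (auto simp: bounded_part_iff)
  have "\<exists>k::int. z [^] k \<sqsubseteq> g \<and> \<not> z [^] (k + 1) \<sqsubseteq> g"
  proof (rule ccontr)
    assume *: "\<not> ?thesis"
    \<comment> \<open>Division with remainder: without a last power below \<open>g\<close>, every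
      power from \<open>i\<close> on would lie below it, against the upper bound
      \<open>z [^] j\<close>.\<close>
    have "z [^] k \<sqsubseteq> g" if "i \<le> k" for k :: int
      using that by (induction k rule: int_ge_induct) (use i * in blast)+
    then have "z [^] max i (j + 1) \<sqsubseteq> g" by simp
    then have "z [^] max i (j + 1) \<sqsubseteq> z [^] j"
      using j g by (blast intro: le_trans)
    then show False by (simp add: z_pow_le_iff)
  qed
  then obtain k :: int where k: "z [^] k \<sqsubseteq> g" "\<not> z [^] (k + 1) \<sqsubseteq> g" by blast
  define h where "h = inv (z [^] k) \<otimes> g"
  have gh: "g = z [^] k \<otimes> h"
    using g by (simp add: h_def mult_inv_cancel)
  have h: "h \<in> P"
    using k(1) by (simp add: h_def lo_le_def)
  have "\<not> z [^] k \<otimes> z \<sqsubseteq> z [^] k \<otimes> h"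
    using k(2) gh by (simp add: int_pow_mult)
  then have "\<not> z \<sqsubseteq> h"
    using h by (subst (asm) le_mult_left) auto
  then show ?thesis
    using le_total[of z h] h gh by (intro that[of k h]) auto
qed

lemma bt_bounded:
  assumes g: "g \<in> F n"
  shows "bt g k \<in> G'"
proof -
  have b: "B g i \<in> G'" if "i \<le> Suc n" for i
  proof -
    have "z [^] (0::int) \<sqsubseteq> B g i" "B g i \<sqsubseteq> z [^] (1::int)"
      using g that pp_pos[OF g that] pp_le_z[OF g that] by auto
    then show ?thesis
      using g bounded_part_iff by blast
  qed
  have "nat (k mod (int n + 1)) \<le> Suc n"
    using pos_mod_bound[of "int n + 1" k] by linarith
  then show ?thesis
    unfolding bt_def using F_length[OF g] z_pow_bounded b
    by (simp add: subgroup.m_closed[OF bounded_part_subgroup] add.commute)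
qed

section \<open>The map to the quotient group\<close>

text \<open>Any integer exponent of \<gamma> may be chosen: two of them differ by a multiple of n +
  1, which changes \<open>bt g\<close> by a power of \<open>z\<close> and leaves the coset
  alone.\<close>

definition iota_pre :: "((int \<Rightarrow> int) set, 'g) pre_point \<Rightarrow> 'g set" where
  "iota_pre = (\<lambda>(n, \<gamma>, g). coset (bt g (SOME a. \<gamma> = rot n (- a))))"

lemma iota_pre_rot:
  assumes g: "g \<in> F n"
  shows "iota_pre (n, rot n (- a), g) = coset (bt g a)"
proof -
  define b where "b = (SOME b. rot n (- a) = rot n (- b))"
  have "rot n (- a) = rot n (- b)"
    unfolding b_def by (rule someI) (rule refl)
  then obtain q where "b - a = (int n + 1) * q"
    by (auto simp: rot_eq_iff)
  then have "b = a + q * (int n + 1)" by (simp add: algebra_simps)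
  then have "coset (bt g b) = coset (bt g a)"
    using g bt_shift[OF g, of a q] by (auto simp: coset_eq_iff)
  then show ?thesis
    by (simp add: iota_pre_def b_def)
qed

definition iota :: "((int \<Rightarrow> int) set, 'g) pre_point set \<Rightarrow> 'g set" where
  "iota X = the_elem (iota_pre ` X)"

text \<open>Gluing along \<phi> replaces the exponent \<open>a\<close> by its cut \<open>b\<close>,
  and vertex \<open>a\<close> of the pushed-forward tuple is vertex \<open>b\<close> of the original
  one. Both come from the same adjoint, so the coset descends to classes.\<close>

lemma iota_cls:
  assumes g: "g \<in> F n"
  shows "iota (cls C_cyc n (rot n (- a)) g) = coset (bt g a)"
proof -
  have "iota_pre (m, act C_cyc m n \<gamma> (Delta_to_Lam m n \<phi>), g) = iota_pre (n, \<gamma>, F_Delta G m n \<phi> g)"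
    if \<phi>: "\<phi> \<in> Delta_hom m n" and \<gamma>: "\<gamma> \<in> obj C_cyc n" and g: "g \<in> F m" for m n \<phi> \<gamma> g
  proof -
    obtain a where a: "\<gamma> = rot n (- int a)"
      using \<gamma> by (auto simp: obj_C elim: Lam_aut_cases)
    obtain b where b: "\<And>x. periodic_ext m n \<phi> x < int a \<longleftrightarrow> x < b"
      using periodic_ext_cut_exists[OF \<phi>] by blast
    show ?thesis
      unfolding a act_C aut_part_rot_Delta[OF \<phi> b] iota_pre_rot[OF g]
        iota_pre_rot[OF F_Delta_in_F[OF \<phi> g]] F_Delta_bt[OF \<phi> g b] by (rule refl)
  qed
  then have "iota (cls C_cyc n (rot n (- a)) g) = iota_pre (n, rot n (- a), g)"
    unfolding iota_def by (intro lift_cls[OF Delta_closed_C _ g]) (simp_all add: obj_C rot_in_Lam_aut)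
  then show ?thesis
    by (simp add: iota_pre_rot[OF g])
qed

text \<open>The subdivision with the single interior vertex \<open>h\<close>. Marking this vertex
  gives \<open>D h\<close>, the point of the circle at position \<open>h\<close>.\<close>

definition two :: "'g \<Rightarrow> 'g list" where
  "two h = [h, inv h \<otimes> z]"

abbreviation "D h \<equiv> cls C_cyc (Suc 0) (rot (Suc 0) (- 1)) (two h)"

lemma two_in_F:
  assumes "h \<in> P" "h \<sqsubseteq> z"
  shows "two h \<in> F (Suc 0)"
  using assms by (simp add: F_obj_def two_def lo_le_def list_mult_def mult_inv_cancel)

lemma two_pp: "h \<in> carrier G \<Longrightarrow> B (two h) (Suc 0) = h"
  by (simp add: two_def pp_def list_mult_def)

lemma iota_D:
  assumes "h \<in> P" "h \<sqsubseteq> z"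
  shows "iota (D h) = coset h"
  using iota_cls[OF two_in_F[OF assms], of 1] bt_of_nat[OF two_in_F[OF assms], of "Suc 0"] assms
  by (simp add: two_pp)

text \<open>All vertices except the marked one can be forgotten: collapse the indices below
  \<open>a\<close> to 0 and the others to 1. The cut of this map at level 1 is \<open>a\<close>, so
  it relates the two marked tuples. The end a = n + 1 is included.\<close>

lemma cls_C_eq_D:
  assumes g: "g \<in> F n" and a: "a \<le> Suc n"
  shows "cls C_cyc n (rot n (- int a)) g = D (B g a)"
proof -
  define \<phi> where "\<phi> = restrict (\<lambda>i. if i < a then 0 else Suc 0) {..n}"
  have \<phi>: "\<phi> \<in> Delta_hom n (Suc 0)"
    unfolding \<phi>_def by (intro Delta_homI) auto
  have cut: "\<phi> i < Suc 0 \<longleftrightarrow> i < a" if "i \<le> n" for i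
    using that by (simp add: \<phi>_def)
  have ext: "periodic_ext n (Suc 0) \<phi> x < int (Suc 0) \<longleftrightarrow> x < int a" for x
    by (rule periodic_ext_cut[OF \<phi> _ a cut]) simp
  have "F_Delta G n (Suc 0) \<phi> g = two (B g a)"
  proof (rule F_Delta_eqI[OF \<phi> g two_in_F])
    fix l c assume l: "0 < l" "l \<le> Suc 0" and c: "c \<le> Suc n" "\<And>i. i \<le> n \<Longrightarrow> \<phi> i < l \<longleftrightarrow> i < c"
    have "l = Suc 0" using l by simp
    then have "i < c \<longleftrightarrow> i < a" if "i \<le> n" for i
      using cut c(2) that by blast
    then have "c = a"
      using a c(1) by (intro cut_unique[of c n a])
    then show "B (two (B g a)) l = B g c"
      using g \<open>l = Suc 0\<close> two_pp by simp
  qed (use pp_pos[OF g a] pp_le_z[OF g a] in auto)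
  then show ?thesis
    using cls_glue[OF Delta_closed_C \<phi> _ g, of "rot (Suc 0) (- 1)"] aut_part_rot_Delta[OF \<phi> ext]
    by (simp add: act_C obj_C rot_in_Lam_aut)
qed

text \<open>On the tuple with the single entry \<open>z\<close> all rotations are trivial, so its
  vertices 0 and 1, namely the unit and \<open>z\<close>, mark the same point.\<close>

lemma D_one_eq_D_z: "D \<one> = D z"
proof -
  have g: "[z] \<in> F 0"
    by (simp add: F_obj_def list_mult_def z_pos)
  have "rot 0 (- int 1) = rot 0 (- int 0)"
    by (simp add: rot_eq_iff)
  then show ?thesis
    using cls_C_eq_D[OF g, of 0] cls_C_eq_D[OF g, of 1] F_pp_end[OF g] by simp
qed

lemma real_C_cases:
  assumes "c \<in> real C_cyc"
  obtains n a g where "a \<le> n" "g \<in> F n" "c = cls C_cyc n (rot n (- int a)) g"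
  using assms by (metis Lam_aut_cases obj_C real_cases)

text \<open>The value \<open>z\<close> is exchanged for the unit, which marks the same point. On the
  half-open interval that remains, different elements have different cosets.\<close>

lemma real_C_D:
  assumes "c \<in> real C_cyc"
  obtains h where "h \<in> P" "h \<sqsubseteq> z" "h \<noteq> z" "c = D h"
proof -
  obtain n a g where *: "a \<le> n" "g \<in> F n" "c = cls C_cyc n (rot n (- int a)) g"
    using assms by (rule real_C_cases)
  then have "c = D (B g a)" "B g a \<in> P" "B g a \<sqsubseteq> z"
    by (simp_all add: cls_C_eq_D pp_pos pp_le_z)
  moreover have "\<one> \<sqsubseteq> z" using z_pos by simp
  ultimately show ?thesis
    using D_one_eq_D_z z_neq_one one_pos that by (cases "B g a = z") metis+
qed

lemma cls_rot_in_real: "g \<in> F n \<Longrightarrow> cls C_cyc n (rot n c) g \<in> real C_cyc"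
  by (rule cls_in_real) (simp_all add: obj_C rot_in_Lam_aut)

lemma iota_inj:
  assumes "c \<in> real C_cyc" "d \<in> real C_cyc" "iota c = iota d"
  shows "c = d"
proof -
  obtain h where h: "h \<in> P" "h \<sqsubseteq> z" "h \<noteq> z" "c = D h" using assms(1) by (rule real_C_D)
  obtain k where k: "k \<in> P" "k \<sqsubseteq> z" "k \<noteq> z" "d = D k" using assms(2) by (rule real_C_D)
  have "coset h = coset k" using assms(3) h k by (simp add: iota_D)
  then show ?thesis using coset_eq_in_interval[of h k] h k by blast
qed

lemma interval_bounded:
  assumes "h \<in> P" "h \<sqsubseteq> z"
  shows "h \<in> G'"
proof -
  have "z [^] (0::int) \<sqsubseteq> h" "h \<sqsubseteq> z [^] (1::int)" using assms by auto
  then show ?thesis using assms bounded_part_iff by blast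
qed

lemma iota_bij: "bij_betw iota (real C_cyc) (carrier Q)"
  unfolding bij_betw_def
proof
  show "inj_on iota (real C_cyc)" by (rule inj_onI) (rule iota_inj)
  show "iota ` real C_cyc = carrier Q"
  proof
    show "iota ` real C_cyc \<subseteq> carrier Q"
      by (auto elim!: real_C_D simp: iota_D coset_in_Q interval_bounded)
  next
    show "carrier Q \<subseteq> iota ` real C_cyc"
    proof
      fix Y assume "Y \<in> carrier Q"
      then obtain g where g: "g \<in> G'" "Y = coset g" by (auto simp: carrier_Q)
      then obtain k :: int and h where h: "g = z [^] k \<otimes> h" "h \<in> P" "h \<sqsubseteq> z"
        by (metis bounded_part_decomp)
      then have "Y = coset h"
        using g by (auto simp: coset_eq_iff)
      then have "Y = iota (D h)" using h by (simp add: iota_D)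
      moreover have "D h \<in> real C_cyc"
        using two_in_F[OF h(2,3)] by (rule cls_rot_in_real)
      ultimately show "Y \<in> iota ` real C_cyc" by blast
    qed
  qed
qed

lemma iota_in_Q: "c \<in> real C_cyc \<Longrightarrow> iota c \<in> carrier Q"
  using iota_bij by (rule bij_betwE[THEN bspec])

section \<open>Common refinements\<close>

text \<open>The last vertex not above \<open>h\<close>; the vertices start at the unit and end at
  \<open>z\<close>, which is not below \<open>h\<close>. The strict condition on the right keeps the
  index unique even when vertices coincide.\<close>

lemma position_exists:
  assumes g: "g \<in> F n" and h: "h \<in> P" "h \<sqsubseteq> z" "h \<noteq> z"
  obtains i where "i \<le> n" "B g i \<sqsubseteq> h" "\<not> B g (Suc i) \<sqsubseteq> h"
proof -
  have "\<exists>i\<le>n. B g i \<sqsubseteq> h \<and> \<not> B g (Suc i) \<sqsubseteq> h"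
  proof (rule ccontr)
    assume *: "\<not> ?thesis"
    have "B g i \<sqsubseteq> h" if "i \<le> Suc n" for i
      using that by (induction i) (use h * in auto)
    then have "z \<sqsubseteq> h" using F_pp_end[OF g] by force
    then show False using h le_antisym by blast
  qed
  then show ?thesis using that by blast
qed

lemma position_unique:
  assumes g: "g \<in> F n" and h: "h \<in> carrier G"
    and "i \<le> n" "B g i \<sqsubseteq> h" "\<not> B g (Suc i) \<sqsubseteq> h"
    and "j \<le> n" "B g j \<sqsubseteq> h" "\<not> B g (Suc j) \<sqsubseteq> h"
  shows "i = j"
proof -
  have "\<not> i < j" if "\<not> B g (Suc i) \<sqsubseteq> h" "B g j \<sqsubseteq> h" "j \<le> n" for i j
  proof
    assume "i < j"
    then have "B g (Suc i) \<sqsubseteq> B g j" using pp_mono[OF g, of "Suc i" j] that by simp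
    then show False using that le_trans[OF _ that(2)] g h by blast
  qed
  then show ?thesis using assms by (meson linorder_neqE_nat)
qed

text \<open>The point \<open>d\<close> sits at some \<open>h\<close>, which is inserted into
  \<open>g\<close> as the vertex i + 1. The degeneracy sending both i and i + 1 to i multiplies the
  two pieces back together.\<close>

lemma refine:
  assumes g: "g \<in> F n" and d: "d \<in> real C_cyc"
  obtains m \<phi> g' a where "\<phi> \<in> Delta_hom m n" "g' \<in> F m" "F_Delta G m n \<phi> g' = g"
    "a \<le> m" "d = cls C_cyc m (rot m (- int a)) g'"
proof -
  obtain h where h: "h \<in> P" "h \<sqsubseteq> z" "h \<noteq> z" "d = D h"
    using d by (rule real_C_D)
  obtain i where i: "i \<le> n" "B g i \<sqsubseteq> h" "\<not> B g (Suc i) \<sqsubseteq> h"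
    using position_exists[OF g h(1-3)] by blast
  have hi: "h \<sqsubseteq> B g (Suc i)"
    using i(3) le_total[of h "B g (Suc i)"] h g by blast
  define b where "b l = (if l \<le> i then B g l else if l = Suc i then h else B g (l - 1))" for l
  define g' where "g' = tuple (Suc n) b"
  have b: "b 0 = \<one>" "b (Suc (Suc n)) = z" "b l \<in> carrier G" for l
    using i g h by (auto simp: b_def F_pp_end)
  have "b l \<sqsubseteq> b (Suc l)" if l: "l \<le> Suc n" for l
  proof -
    consider "l < i" | "l = i" | "l = Suc i" | "Suc i < l" by linarith
    then show ?thesis
    proof cases
      case 1 then show ?thesis using i pp_mono[OF g, of l "Suc l"] by (simp add: b_def)
    next
      case 2 then show ?thesis using i by (simp add: b_def)
    next
      case 3 then show ?thesis using hi by (simp add: b_def)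
    next
      case 4 then show ?thesis using l pp_mono[OF g, of "l - 1" l] by (simp add: b_def)
    qed
  qed
  then have g': "g' \<in> F (Suc n)"
    unfolding g'_def using b by (intro tuple_in_F)
  have ppg': "B g' l = b l" if "l \<le> Suc (Suc n)" for l
    unfolding g'_def using that b by (intro tuple_pp) auto
  define \<phi> where "\<phi> = restrict (\<lambda>k. if k \<le> i then k else k - 1) {..Suc n}"
  have \<phi>: "\<phi> \<in> Delta_hom (Suc n) n"
    unfolding \<phi>_def using i by (intro Delta_homI) auto
  have "F_Delta G (Suc n) n \<phi> g' = g"
  proof (rule F_Delta_eqI[OF \<phi> g' g])
    fix l c assume l: "0 < l" "l \<le> n" and c: "c \<le> Suc (Suc n)"
      "\<And>k. k \<le> Suc n \<Longrightarrow> \<phi> k < l \<longleftrightarrow> k < c"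
    \<comment> \<open>The cut of the degeneracy passes over the inserted vertex i + 1.\<close>
    define c' where "c' = (if l \<le> i then l else Suc l)"
    have c': "k < c' \<longleftrightarrow> \<phi> k < l" if "k \<le> Suc n" for k
      using that by (auto simp: c'_def \<phi>_def)
    then have "c = c'"
      using c l by (intro cut_unique[of c "Suc n" c']) (auto simp: c'_def)
    then show "B g l = B g' c"
      using ppg'[of c] c(1) by (auto simp: b_def c'_def)
  qed
  moreover have "d = cls C_cyc (Suc n) (rot (Suc n) (- int (Suc i))) g'"
    using i h(4) ppg'[of "Suc i"] by (subst cls_C_eq_D[OF g']) (simp_all add: b_def)
  ultimately show ?thesis
    using that[OF \<phi> g' _ _] i by blast
qed

lemma coset_bt_mult:
  assumes g: "g \<in> F n"
  shows "coset (bt g (int a)) \<otimes>\<^bsub>Q\<^esub> coset (bt (rotate a g) k) = coset (bt g (int a + k))"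
  by (subst coset_mult[OF bt_bounded[OF g] bt_bounded[OF rotate_in_F[OF g]]])
    (use g in \<open>simp add: rotate_bt[OF g] mult_inv_cancel\<close>)

text \<open>The point \<open>d\<close> must be marked on the tuple already rotated for
  \<open>c\<close>. Marking the product of \<open>c\<close> and \<open>d\<close> on the unrotated
  tuple achieves this, with the difference of the two exponents as the exponent for
  \<open>d\<close>.\<close>

lemma common_representatives:
  assumes S: "Delta_closed S" and X: "X \<in> real S" and c: "c \<in> real C_cyc" and d: "d \<in> real C_cyc"
  obtains n x g a b where "x \<in> obj S n" "g \<in> F n" "X = cls S n x g"
    "c = cls C_cyc n (rot n (- int a)) g"
    "d = cls C_cyc n (rot n (- int b)) (rotate a g)"
proof -
  interpret Q: group Q by (rule group_Q)
  obtain n x g where x: "x \<in> obj S n" and g: "g \<in> F n" and Xe: "X = cls S n x g"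
    using X by (rule real_cases)
  obtain m \<phi> g' a where \<phi>: "\<phi> \<in> Delta_hom m n" and g': "g' \<in> F m" and gg': "F_Delta G m n \<phi> g' = g"
    and ca: "c = cls C_cyc m (rot m (- int a)) g'"
    using refine[OF g c] by metis
  \<comment> \<open>The product in the quotient group, pulled back along \<open>iota\<close>; no
    group law on the realization is involved yet.\<close>
  define e where "e = inv_into (real C_cyc) iota (iota c \<otimes>\<^bsub>Q\<^esub> iota d)"
  have prod: "iota c \<otimes>\<^bsub>Q\<^esub> iota d \<in> carrier Q"
    using c d by (intro Q.m_closed iota_in_Q)
  then have e: "e \<in> real C_cyc" "iota e = iota c \<otimes>\<^bsub>Q\<^esub> iota d"
    unfolding e_def using iota_bij bij_betw_inv_into_right[OF iota_bij]
    by (auto simp: bij_betw_def inv_into_into)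
  obtain p \<psi> g'' s where \<psi>: "\<psi> \<in> Delta_hom p m" and g'': "g'' \<in> F p"
    and g'g'': "F_Delta G p m \<psi> g'' = g'" and es: "e = cls C_cyc p (rot p (- int s)) g''"
    using refine[OF g' e(1)] by metis
  define x' where "x' = act S m n x (Delta_to_Lam m n \<phi>)"
  have x': "x' \<in> obj S m" using S x \<phi> by (simp add: x'_def Delta_closed_def)
  define x'' where "x'' = act S p m x' (Delta_to_Lam p m \<psi>)"
  have x'': "x'' \<in> obj S p" using S x' \<psi> by (simp add: x''_def Delta_closed_def)
  \<comment> \<open>The second refinement renumbers the vertex that marks \<open>c\<close>;
    \<open>q\<close> is its new exponent.\<close>
  define \<gamma> where "\<gamma> = act C_cyc p m (rot m (- int a)) (Delta_to_Lam p m \<psi>)"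
  have \<gamma>: "\<gamma> \<in> Lam_aut p"
    using Delta_closed_C \<psi> rot_in_Lam_aut by (simp add: \<gamma>_def Delta_closed_def obj_C)
  then obtain q where q: "\<gamma> = rot p (- int q)" by (blast elim: Lam_aut_cases)
  have X'': "X = cls S p x'' g''"
    using cls_glue[OF S \<psi> x' g''] cls_glue[OF S \<phi> x g'] by (simp add: x''_def x'_def Xe gg' g'g'')
  have c'': "c = cls C_cyc p (rot p (- int q)) g''"
    using cls_glue[OF Delta_closed_C \<psi> _ g'', of "rot m (- int a)"]
    by (simp add: ca g'g'' obj_C rot_in_Lam_aut q[symmetric] \<gamma>_def)
  \<comment> \<open>The difference of exponents may be negative and is replaced by a natural number
    in the same residue class.\<close>
  obtain b where b: "rot p (- (int s - int q)) = rot p (- int b)"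
    using Lam_aut_cases[OF rot_in_Lam_aut] by metis
  define d' where "d' = cls C_cyc p (rot p (- int b)) (rotate q g'')"
  have r: "rotate q g'' \<in> F p" by (rule rotate_in_F[OF g''])
  have d': "d' \<in> real C_cyc" unfolding d'_def by (rule cls_rot_in_real[OF r])
  have "iota c \<otimes>\<^bsub>Q\<^esub> iota d' = iota e"
    using coset_bt_mult[OF g'', of q "int s - int q"]
    by (simp only: c'' d'_def b[symmetric] es iota_cls[OF g''] iota_cls[OF r]) simp
  \<comment> \<open>Cancelling the factor of \<open>c\<close> in the quotient group identifies the
    candidate \<open>d'\<close> with \<open>d\<close>.\<close>
  then have "iota d' = iota d"
    using Q.Units_l_cancel[of "iota c" "iota d'" "iota d"]
    by (simp only: e(2) Q.Units_eq iota_in_Q[OF c] iota_in_Q[OF d] iota_in_Q[OF d'])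
  then have "d = d'" using iota_inj d d' by metis
  then show ?thesis
    using that[OF x'' g'' X'' c''] by (simp add: d'_def)
qed

section \<open>The group law\<close>

definition C_group :: "((int \<Rightarrow> int) set, 'g) pre_point set monoid" where
  "C_group = \<lparr>carrier = real C_cyc,
     mult = (\<lambda>c\<in>real C_cyc. \<lambda>d\<in>real C_cyc. inv_into (real C_cyc) iota (iota c \<otimes>\<^bsub>Q\<^esub> iota d)),
     one = inv_into (real C_cyc) iota \<one>\<^bsub>Q\<^esub>\<rparr>"

lemma iota_inv_into: "q \<in> carrier Q \<Longrightarrow> iota (inv_into (real C_cyc) iota q) = q"
  by (rule bij_betw_inv_into_right[OF iota_bij])

lemma inv_into_in_real: "q \<in> carrier Q \<Longrightarrow> inv_into (real C_cyc) iota q \<in> real C_cyc"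
  using bij_betw_imp_surj_on[OF iota_bij] by (metis inv_into_into)

lemma carrier_C_group: "carrier C_group = real C_cyc"
  by (simp add: C_group_def)

lemma C_group_mult:
  assumes "c \<in> real C_cyc" "d \<in> real C_cyc"
  shows "c \<otimes>\<^bsub>C_group\<^esub> d \<in> real C_cyc" "iota (c \<otimes>\<^bsub>C_group\<^esub> d) = iota c \<otimes>\<^bsub>Q\<^esub> iota d"
proof -
  have "iota c \<otimes>\<^bsub>Q\<^esub> iota d \<in> carrier Q"
    using assms by (intro monoid.m_closed[OF group.is_monoid[OF group_Q]] iota_in_Q)
  moreover have "c \<otimes>\<^bsub>C_group\<^esub> d = inv_into (real C_cyc) iota (iota c \<otimes>\<^bsub>Q\<^esub> iota d)"
    using assms by (simp add: C_group_def)
  ultimately show "c \<otimes>\<^bsub>C_group\<^esub> d \<in> real C_cyc" "iota (c \<otimes>\<^bsub>C_group\<^esub> d) = iota c \<otimes>\<^bsub>Q\<^esub> iota d"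
    by (simp_all only: iota_inv_into inv_into_in_real)
qed

lemma C_group_one: "\<one>\<^bsub>C_group\<^esub> \<in> real C_cyc" "iota \<one>\<^bsub>C_group\<^esub> = \<one>\<^bsub>Q\<^esub>"
proof -
  have "\<one>\<^bsub>Q\<^esub> \<in> carrier Q" by (rule monoid.one_closed[OF group.is_monoid[OF group_Q]])
  moreover have "\<one>\<^bsub>C_group\<^esub> = inv_into (real C_cyc) iota \<one>\<^bsub>Q\<^esub>" by (simp add: C_group_def)
  ultimately show "\<one>\<^bsub>C_group\<^esub> \<in> real C_cyc" "iota \<one>\<^bsub>C_group\<^esub> = \<one>\<^bsub>Q\<^esub>"
    by (simp_all only: iota_inv_into inv_into_in_real)
qed

lemma group_C_group: "group C_group"
proof (rule groupI; unfold carrier_C_group)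
  interpret Q: group Q by (rule group_Q)
  note closed = C_group_mult(1) C_group_one(1) and iota = C_group_mult(2) C_group_one(2)
  show "\<one>\<^bsub>C_group\<^esub> \<in> real C_cyc" by (rule closed)
  fix c assume c: "c \<in> real C_cyc"
  note Qc = iota_in_Q[OF c]
  show "\<one>\<^bsub>C_group\<^esub> \<otimes>\<^bsub>C_group\<^esub> c = c"
    by (rule iota_inj) (simp_all only: closed iota c Q.l_one[OF Qc])
  have "inv_into (real C_cyc) iota (inv\<^bsub>Q\<^esub> iota c) \<otimes>\<^bsub>C_group\<^esub> c = \<one>\<^bsub>C_group\<^esub>"
    by (rule iota_inj)
      (simp_all only: closed iota c Qc inv_into_in_real iota_inv_into Q.inv_closed Q.l_inv)
  then show "\<exists>d\<in>real C_cyc. d \<otimes>\<^bsub>C_group\<^esub> c = \<one>\<^bsub>C_group\<^esub>"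
    using inv_into_in_real Q.inv_closed[OF Qc] by blast
  fix d assume d: "d \<in> real C_cyc"
  show "c \<otimes>\<^bsub>C_group\<^esub> d \<in> real C_cyc" by (rule closed(1)[OF c d])
  fix e assume e: "e \<in> real C_cyc"
  show "c \<otimes>\<^bsub>C_group\<^esub> d \<otimes>\<^bsub>C_group\<^esub> e = c \<otimes>\<^bsub>C_group\<^esub> (d \<otimes>\<^bsub>C_group\<^esub> e)"
    by (rule iota_inj)
      (simp_all only: closed iota c d e Q.m_assoc[OF Qc iota_in_Q[OF d] iota_in_Q[OF e]])
qed

lemma iota_cls_mult:
  assumes g: "g \<in> F n"
  shows "iota (cls C_cyc n (rot n (- int a)) g) \<otimes>\<^bsub>Q\<^esub> iota (cls C_cyc n (rot n (- int b)) (rotate a g))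
    = iota (cls C_cyc n (rot n (- int a) \<odot> rot n (- int b)) g)"
proof -
  have "- int a + - int b = - (int a + int b)" by simp
  then show ?thesis
    using coset_bt_mult[OF g, of a "int b"]
    by (simp only: rot_comp iota_cls[OF g] iota_cls[OF rotate_in_F[OF g]])
qed

lemma C_group_law_C_group: "C_group_law G P z C_group"
  unfolding C_group_law_def
proof (intro conjI allI ballI)
  show "group C_group" by (rule group_C_group)
  show "carrier C_group = real C_cyc" by (rule carrier_C_group)
  show "mult C_group \<in> carrier C_group \<rightarrow>\<^sub>E carrier C_group \<rightarrow>\<^sub>E carrier C_group"
  proof (rule PiE_I)
    fix c assume c: "c \<in> carrier C_group"
    show "mult C_group c \<in> carrier C_group \<rightarrow>\<^sub>E carrier C_group"
    proof (rule PiE_I)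
      show "c \<otimes>\<^bsub>C_group\<^esub> d \<in> carrier C_group" if "d \<in> carrier C_group" for d
        using C_group_mult(1) c that by (simp add: carrier_C_group)
      show "c \<otimes>\<^bsub>C_group\<^esub> d = undefined" if "d \<notin> carrier C_group" for d
        using that c by (simp add: C_group_def)
    qed
  qed (simp add: C_group_def)
next
  fix n \<gamma> \<gamma>' g assume \<gamma>: "\<gamma> \<in> Lam_aut n" "\<gamma>' \<in> Lam_aut n" and g: "g \<in> F n"
  obtain a b where ab: "\<gamma> = rot n (- int a)" "\<gamma>' = rot n (- int b)"
    using \<gamma> by (metis Lam_aut_cases)
  show "cls C_cyc n \<gamma> g \<otimes>\<^bsub>C_group\<^esub> cls C_cyc n \<gamma>' (F_Lam G n n \<gamma> g) = cls C_cyc n (\<gamma> \<odot> \<gamma>') g"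
    unfolding ab F_Lam_rot[OF g]
  proof (rule iota_inj)
    show "cls C_cyc n (rot n (- int a) \<odot> rot n (- int b)) g \<in> real C_cyc"
      unfolding rot_comp by (rule cls_rot_in_real[OF g])
  qed (simp_all only: C_group_mult cls_rot_in_real[OF g] cls_rot_in_real[OF rotate_in_F[OF g]] iota_cls_mult[OF g])
qed

lemma C_group_law_carrier: "C_group_law G P z M \<Longrightarrow> carrier M = real C_cyc"
  by (simp add: C_group_law_def)

lemma C_group_law_mult: "C_group_law G P z M \<Longrightarrow> mult M \<in> real C_cyc \<rightarrow>\<^sub>E real C_cyc \<rightarrow>\<^sub>E real C_cyc"
  unfolding C_group_law_def by metis

lemma C_group_law_rot:
  assumes M: "C_group_law G P z M" and g: "g \<in> F n"
  shows "cls C_cyc n (rot n (- int a)) g \<otimes>\<^bsub>M\<^esub> cls C_cyc n (rot n (- int b)) (rotate a g)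
    = cls C_cyc n (rot n (- int a) \<odot> rot n (- int b)) g"
  using M g rot_in_Lam_aut F_Lam_rot[OF g] unfolding C_group_law_def by metis

text \<open>Any two elements lie on a common tuple in the form required by the prescribed rule, so
  every law satisfying the rule is the one transported from the quotient group.\<close>

lemma C_group_law_iota:
  assumes M: "C_group_law G P z M" and c: "c \<in> real C_cyc" and d: "d \<in> real C_cyc"
  shows "iota (c \<otimes>\<^bsub>M\<^esub> d) = iota c \<otimes>\<^bsub>Q\<^esub> iota d"
proof -
  \<comment> \<open>The extra point that the refinement asks for is taken to be \<open>c\<close>
    itself.\<close>
  obtain n x g a b where "x \<in> obj C_cyc n" and g: "g \<in> F n" and "c = cls C_cyc n x g"
    and ab: "c = cls C_cyc n (rot n (- int a)) g" "d = cls C_cyc n (rot n (- int b)) (rotate a g)"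
    using common_representatives[OF Delta_closed_C c c d] .
  show ?thesis
    by (simp only: ab C_group_law_rot[OF M g] iota_cls_mult[OF g])
qed

lemma C_group_law_one:
  assumes M: "C_group_law G P z M"
  shows "iota \<one>\<^bsub>M\<^esub> = \<one>\<^bsub>Q\<^esub>"
proof -
  interpret M: group M using M by (simp add: C_group_law_def)
  interpret Q: group Q by (rule group_Q)
  have one: "\<one>\<^bsub>M\<^esub> \<in> real C_cyc"
    using M.one_closed by (simp add: C_group_law_carrier[OF M])
  then have "iota \<one>\<^bsub>M\<^esub> \<otimes>\<^bsub>Q\<^esub> iota \<one>\<^bsub>M\<^esub> = iota \<one>\<^bsub>M\<^esub>"
    using C_group_law_iota[OF M one one] by simp
  then show ?thesis
    using iota_in_Q[OF one] Q.l_cancel_one by blast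
qed

lemma C_group_law_unique:
  assumes M: "C_group_law G P z M"
  shows "M = C_group"
proof (rule monoid.equality)
  interpret M: group M using M by (simp add: C_group_law_def)
  note carrier_M = C_group_law_carrier[OF M]
  show "carrier M = carrier C_group" by (simp add: carrier_M carrier_C_group)
  \<comment> \<open>The record contains the unit as well; it is determined by the
    multiplication.\<close>
  show "one M = one C_group"
    using M.one_closed C_group_one C_group_law_one[OF M]
    by (intro iota_inj) (simp_all only: carrier_M)
  note ext = C_group_law_mult[OF M] C_group_law_mult[OF C_group_law_C_group]
  show "mult M = mult C_group"
  proof (rule PiE_ext[OF ext])
    fix c assume c: "c \<in> real C_cyc"
    show "mult M c = mult C_group c"
    proof (rule PiE_ext[OF PiE_mem[OF ext(1) c] PiE_mem[OF ext(2) c]])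
      fix d assume d: "d \<in> real C_cyc"
      show "c \<otimes>\<^bsub>M\<^esub> d = c \<otimes>\<^bsub>C_group\<^esub> d"
      proof (rule iota_inj)
        show "c \<otimes>\<^bsub>M\<^esub> d \<in> real C_cyc"
          using M.m_closed c d by (simp only: carrier_M)
      qed (simp_all only: C_group_mult[OF c d] C_group_law_iota[OF M c d])
    qed
  qed
qed simp

section \<open>The isomorphism onto the quotient group\<close>

lemma is_iota_iff: "is_iota G P z \<iota> \<longleftrightarrow> \<iota> = restrict iota (real C_cyc)"
proof
  assume \<iota>: "is_iota G P z \<iota>"
  show "\<iota> = restrict iota (real C_cyc)"
  proof (rule extensionalityI)
    show "\<iota> \<in> extensional (real C_cyc)" using \<iota> by (simp add: is_iota_def)
    fix c assume c: "c \<in> real C_cyc"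
    then obtain n a g where a: "a \<le> n" and g: "g \<in> F n" and ce: "c = cls C_cyc n (rot n (- int a)) g"
      by (rule real_C_cases)
    have "\<iota> c = coset (B g a)"
      using \<iota> a g by (simp add: is_iota_def ce tau_pow_rot pp_def)
    also have "\<dots> = iota c"
      using a by (simp add: ce iota_cls[OF g] bt_of_nat[OF g])
    finally show "\<iota> c = restrict iota (real C_cyc) c" using c by simp
  qed simp
next
  assume "\<iota> = restrict iota (real C_cyc)"
  then show "is_iota G P z \<iota>"
    by (simp add: is_iota_def tau_pow_rot cls_rot_in_real iota_cls bt_of_nat pp_def)
qed

lemma iota_iso:
  assumes M: "C_group_law G P z M"
  shows "restrict iota (real C_cyc) \<in> iso M Q"
proof -
  interpret M: group M using M by (simp add: C_group_law_def)
  have closed: "c \<otimes>\<^bsub>M\<^esub> d \<in> real C_cyc" if "c \<in> real C_cyc" "d \<in> real C_cyc" for c d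
    using that M.m_closed by (simp add: C_group_law_carrier[OF M])
  have "bij_betw (restrict iota (real C_cyc)) (real C_cyc) (carrier Q)"
    using iota_bij by (simp add: bij_betw_def inj_on_def)
  moreover have "restrict iota (real C_cyc) \<in> hom M Q"
    by (rule homI)
      (simp_all only: C_group_law_carrier[OF M] restrict_apply closed if_True iota_in_Q C_group_law_iota[OF M])
  ultimately show ?thesis
    by (simp add: iso_def C_group_law_carrier[OF M])
qed

end

section \<open>Operation of periodic maps on a cyclic set\<close>

lemma act_comp:
  assumes "cyclic_set S" "x \<in> obj S n" "f \<in> periodic_maps m n" "g \<in> periodic_maps l m"
  shows "act S l m (act S m n x (shift_class n f)) (shift_class m g) = act S l n x (shift_class n (f \<circ> g))"
  using assms shift_class_in_Lam_hom[OF assms(3)] shift_class_in_Lam_hom[OF assms(4)]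
  unfolding Lam_comp_shift_class[OF assms(3), symmetric] cyclic_set_def by simp

lemma act_in_obj:
  assumes "cyclic_set S" "x \<in> obj S n" "f \<in> periodic_maps m n"
  shows "act S m n x (shift_class n f) \<in> obj S m"
  using assms shift_class_in_Lam_hom[OF assms(3)] unfolding cyclic_set_def by simp

lemma act_rot_in_obj: "cyclic_set S \<Longrightarrow> x \<in> obj S n \<Longrightarrow> act S n n x (rot n c) \<in> obj S n"
  unfolding rot_def by (intro act_in_obj periodic_maps_add)

lemma act_rot_rot:
  assumes "cyclic_set S" "x \<in> obj S n"
  shows "act S n n (act S n n x (rot n c)) (rot n d) = act S n n x (rot n (c + d))"
  using assms rot_in_Lam_hom[of n c] rot_in_Lam_hom[of n d]
  unfolding rot_comp[symmetric] cyclic_set_def by simp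

lemma act_Lam_id: "cyclic_set S \<Longrightarrow> x \<in> obj S n \<Longrightarrow> act S n n x (Lam_id n) = x"
  by (simp add: cyclic_set_def)

section \<open>The action\<close>

text \<open>Splitting the entry \<open>g\<^sub>i\<close> of a tuple into two and rotating so that its second half comes first
  is induced by the morphism from \<open>[n + 1]\<close> to \<open>[n]\<close> represented by \<open>y \<mapsto> y + i\<close> on
  \<open>{0,\<dots>,n + 1}\<close>.\<close>

definition split_rot :: "nat \<Rightarrow> nat \<Rightarrow> int \<Rightarrow> int" where
  "split_rot n i = (\<lambda>x. x + int i) \<circ>
     (periodic_ext (Suc n) n (restrict (\<lambda>k. k - 1) {..Suc n}) \<circ> (\<lambda>x. x + 1))"

lemma split_rot_in_periodic_maps: "split_rot n i \<in> periodic_maps (Suc n) n"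
proof -
  have "restrict (\<lambda>k. k - 1) {..Suc n} \<in> Delta_hom (Suc n) n"
    by (intro Delta_homI) auto
  note per = periodic_ext_in_periodic_maps[OF this]
  show ?thesis
    unfolding split_rot_def
    by (rule periodic_maps_comp[OF periodic_maps_add periodic_maps_comp[OF per periodic_maps_add]])
qed

lemma split_rot_apply:
  assumes "0 \<le> y" "y \<le> int (Suc n)"
  shows "split_rot n i y = y + int i"
proof -
  define \<sigma> where "\<sigma> = restrict (\<lambda>k. k - 1) {..Suc n}"
  have "periodic_ext (Suc n) n \<sigma> (y + 1) = y"
  proof (cases "y = int (Suc n)")
    \<comment> \<open>Here y + 1 = n + 2 is a full period of the source, so the value n + 1 comes
      from the periodic extension.\<close>
    case True
    then show ?thesis
      using periodic_ext_shift[of "Suc n" n \<sigma> 0 1] periodic_ext_of_nat[of 0 "Suc n" n \<sigma>]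
      by (simp add: \<sigma>_def add.commute)
  next
    case False
    then show ?thesis
      using assms periodic_ext_of_nat[of "Suc (nat y)" "Suc n" n \<sigma>]
      by (simp add: \<sigma>_def add.commute)
  qed
  then show ?thesis by (simp add: split_rot_def \<sigma>_def)
qed

context central_interval
begin

text \<open>The periodic chain of \<open>g\<close> with \<open>h\<close> inserted between vertices i
  and i + 1 and taken as origin; the following n + 1 vertices become the interior ones.\<close>

definition split_tuple :: "nat \<Rightarrow> nat \<Rightarrow> 'g \<Rightarrow> 'g list \<Rightarrow> 'g list" where
  "split_tuple n i h g = tuple (Suc n)
     (\<lambda>l. if l = 0 then \<one> else if l = Suc (Suc n) then z else inv h \<otimes> bt g (int i + int l))"

lemma
  assumes g: "g \<in> F n" and h: "h \<in> carrier G" and i: "i \<le> n" "B g i \<sqsubseteq> h" "h \<sqsubseteq> B g (Suc i)"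
  shows split_tuple_in_F: "split_tuple n i h g \<in> F (Suc n)"
    and split_tuple_pp: "\<And>l. 0 < l \<Longrightarrow> l \<le> Suc n \<Longrightarrow>
      B (split_tuple n i h g) l = inv h \<otimes> bt g (int i + int l)"
proof -
  define b where "b l = (if l = 0 then \<one> else if l = Suc (Suc n) then z
    else inv h \<otimes> bt g (int i + int l))" for l
  have st: "split_tuple n i h g = tuple (Suc n) b"
    by (simp add: split_tuple_def b_def[abs_def])
  have b: "b 0 = \<one>" "b (Suc (Suc n)) = z" "b l \<in> carrier G" for l
    using g h by (simp_all add: b_def)
  have "b l \<sqsubseteq> b (Suc l)" if l: "l \<le> Suc n" for l
  proof -
    consider "l = 0" | "0 < l" "l \<le> n" | "l = Suc n" using l by linarith
    then show ?thesis
    proof cases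
      case 1
      have "bt g (int i + 1) = B g (Suc i)"
        using bt_of_nat[OF g, of "Suc i"] i by (simp add: add.commute)
      then show ?thesis
        using i(3) 1 g h by (simp add: b_def lo_le_def)
    next
      case 2
      then show ?thesis
        using g h bt_mono[OF g, of "int i + int l" "int i + int (Suc l)"] by (simp add: b_def)
    next
      case 3
      \<comment> \<open>The last interior vertex is vertex i one period later. It stays below z h
        because vertex i is below \<open>h\<close>, and z h becomes \<open>z\<close> after division
        by \<open>h\<close>.\<close>
      have "bt g (int i + int (Suc n)) = z \<otimes> B g i"
        using bt_shift[OF g, of "int i" 1] bt_of_nat[OF g, of i] i by (simp add: add.commute add.left_commute)
      moreover have "z = inv h \<otimes> (z \<otimes> h)"
        using h z_central[OF h] by (simp add: inv_mult_cancel)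
      moreover have "inv h \<otimes> (z \<otimes> B g i) \<sqsubseteq> inv h \<otimes> (z \<otimes> h)"
        using g h i by simp
      ultimately have "inv h \<otimes> bt g (int i + int (Suc n)) \<sqsubseteq> z" by simp
      then show ?thesis
        using 3 b(2) by (simp add: b_def)
    qed
  qed
  then show "split_tuple n i h g \<in> F (Suc n)"
    unfolding st using b by (intro tuple_in_F)
  show "B (split_tuple n i h g) l = inv h \<otimes> bt g (int i + int l)" if "0 < l" "l \<le> Suc n" for l
    unfolding st using that b by (subst tuple_pp) (simp_all add: b_def)
qed

definition position :: "nat \<Rightarrow> 'g list \<Rightarrow> 'g \<Rightarrow> nat" where
  "position n g h = (THE i. i \<le> n \<and> B g i \<sqsubseteq> h \<and> \<not> B g (Suc i) \<sqsubseteq> h)"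

lemma position_eqI:
  assumes "g \<in> F n" "h \<in> carrier G" "i \<le> n" "B g i \<sqsubseteq> h" "\<not> B g (Suc i) \<sqsubseteq> h"
  shows "position n g h = i"
  unfolding position_def
proof (rule the_equality)
  fix j assume "j \<le> n \<and> B g j \<sqsubseteq> h \<and> \<not> B g (Suc j) \<sqsubseteq> h"
  then show "j = i" using position_unique[OF assms(1,2)] assms(3-5) by blast
qed (use assms in blast)

definition shift_pre :: "'s cyclic \<Rightarrow> 'g \<Rightarrow> ('s, 'g) pre_point \<Rightarrow> ('s, 'g) pre_point set" where
  "shift_pre S h = (\<lambda>(n, x, g). let i = position n g h in
     cls S (Suc n) (act S (Suc n) n x (shift_class n (split_rot n i))) (split_tuple n i h g))"

lemma cls_eqI:
  assumes S: "Delta_closed S" and \<phi>: "\<phi> \<in> Delta_hom m n" and x: "x \<in> obj S n"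
    and g: "g \<in> F m" and g': "g' \<in> F n"
    and eq: "\<And>l c. \<lbrakk>0 < l; l \<le> n; c \<le> Suc m; \<And>i. i \<le> m \<Longrightarrow> \<phi> i < l \<longleftrightarrow> i < c\<rbrakk> \<Longrightarrow> B g' l = B g c"
  shows "cls S m (act S m n x (Delta_to_Lam m n \<phi>)) g = cls S n x g'"
proof -
  have "F_Delta G m n \<phi> g = g'"
    by (rule F_Delta_eqI[OF \<phi> g g']) (rule eq)
  then show ?thesis using cls_glue[OF S \<phi> x g] by simp
qed

text \<open>The index i lies between the cuts of \<phi> at levels \<phi>(i) and \<phi>(i) + 1, and
  these cuts give the two vertices of the image around level \<phi>(i).\<close>

lemma position_F_Delta:
  assumes \<phi>: "\<phi> \<in> Delta_hom m n" and g: "g \<in> F m" and h: "h \<in> carrier G"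
    and i: "i \<le> m" "B g i \<sqsubseteq> h" "\<not> B g (Suc i) \<sqsubseteq> h"
  shows "B (F_Delta G m n \<phi> g) (\<phi> i) \<sqsubseteq> h" "\<not> B (F_Delta G m n \<phi> g) (Suc (\<phi> i)) \<sqsubseteq> h"
proof -
  have \<phi>i: "\<phi> i \<le> n" by (rule Delta_hom_le[OF \<phi> i(1)])
  obtain c where c: "c \<le> Suc m" "\<And>k. k \<le> m \<Longrightarrow> \<phi> k < \<phi> i \<longleftrightarrow> k < c"
    using Delta_cut_exists[OF \<phi>] by blast
  obtain d where d: "d \<le> Suc m" "\<And>k. k \<le> m \<Longrightarrow> \<phi> k < Suc (\<phi> i) \<longleftrightarrow> k < d"
    using Delta_cut_exists[OF \<phi>] by blast
  have "c \<le> i" "i < d" using c(2)[OF i(1)] d(2)[OF i(1)] by auto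
  have "B g c \<sqsubseteq> B g i" using \<open>c \<le> i\<close> i(1) by (intro pp_mono[OF g]) auto
  then have "B g c \<sqsubseteq> h" using i(2) g h by (blast intro: le_trans)
  then show "B (F_Delta G m n \<phi> g) (\<phi> i) \<sqsubseteq> h"
    using F_Delta_pp[OF \<phi> g _ c] \<phi>i by simp
  have "B g (Suc i) \<sqsubseteq> B g d" using \<open>i < d\<close> d(1) by (intro pp_mono[OF g]) auto
  then have "\<not> B g d \<sqsubseteq> h" using i(3) g h by (blast intro: le_trans)
  then show "\<not> B (F_Delta G m n \<phi> g) (Suc (\<phi> i)) \<sqsubseteq> h"
    using F_Delta_pp[OF \<phi> g _ d] \<phi>i by simp
qed

text \<open>Naturality of splitting: \<phi> induces a map \<psi> between the split index sets. It
  forms a commutative square with the two \<open>split_rot\<close> maps and pushes one split tuple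
  to the other, so a single gluing along \<psi> suffices.\<close>

lemma shift_pre_glue:
  assumes S: "cyclic_set S" and h: "h \<in> P" "h \<sqsubseteq> z" "h \<noteq> z"
    and \<phi>: "\<phi> \<in> Delta_hom m n" and x: "x \<in> obj S n" and g: "g \<in> F m"
  shows "shift_pre S h (m, act S m n x (Delta_to_Lam m n \<phi>), g) = shift_pre S h (n, x, F_Delta G m n \<phi> g)"
proof -
  have hc: "h \<in> carrier G" using h by blast
  define g' where "g' = F_Delta G m n \<phi> g"
  have g': "g' \<in> F n" unfolding g'_def by (rule F_Delta_in_F[OF \<phi> g])
  obtain i where i: "i \<le> m" "B g i \<sqsubseteq> h" "\<not> B g (Suc i) \<sqsubseteq> h"
    using position_exists[OF g h] .
  define j where "j = \<phi> i"
  have j: "j \<le> n" "B g' j \<sqsubseteq> h" "\<not> B g' (Suc j) \<sqsubseteq> h"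
    using Delta_hom_le[OF \<phi> i(1)] position_F_Delta[OF \<phi> g hc i] by (simp_all add: j_def g'_def)
  have hi: "h \<sqsubseteq> B g (Suc i)" using le_total[OF hc F_pp_closed[OF g]] i(3) by blast
  have hj: "h \<sqsubseteq> B g' (Suc j)" using le_total[OF hc F_pp_closed[OF g']] j(3) by blast
  define f where "f = periodic_ext m n \<phi>"
  have f: "f \<in> periodic_maps m n" unfolding f_def by (rule periodic_ext_in_periodic_maps[OF \<phi>])
  have f_i: "f (int i) = int j" using periodic_ext_of_nat[OF i(1)] by (simp add: f_def j_def)
  have f_end: "f (int i + int (Suc m)) = int j + int (Suc n)"
    using periodic_maps_shift[OF f, of "int i" 1] f_i by (simp add: add.commute add.left_commute)
  have bounds: "int j \<le> f (int i + int k)" "f (int i + int k) \<le> int j + int (Suc n)" if "k \<le> Suc m" for k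
    using periodic_maps_mono[OF f, of "int i" "int i + int k"]
      periodic_maps_mono[OF f, of "int i + int k" "int i + int (Suc m)"] that f_i f_end by auto
  \<comment> \<open>\<psi> reads the periodic extension on the m + 2 integers from i to i + m + 1
    and renumbers them from 0. The two ends go to j and j + n + 1, hence to 0 and n + 1.\<close>
  define \<psi> where "\<psi> = restrict (\<lambda>k. nat (f (int i + int k) - int j)) {..Suc m}"
  have \<psi>_val: "int (\<psi> k) = f (int i + int k) - int j" if "k \<le> Suc m" for k
    using bounds[OF that] that by (simp add: \<psi>_def)
  have \<psi>: "\<psi> \<in> Delta_hom (Suc m) (Suc n)"
    unfolding \<psi>_def
  proof (rule Delta_homI)
    show "nat (f (int i + int k) - int j) \<le> Suc n" if "k \<le> Suc m" for k
      using bounds[OF that] by linarith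
    show "nat (f (int i + int k) - int j) \<le> nat (f (int i + int l) - int j)" if "k \<le> l" for k l
      using periodic_maps_mono[OF f, of "int i + int k" "int i + int l"] that by (intro nat_mono) simp
  qed
  have maps: "f \<circ> split_rot m i = split_rot n j \<circ> periodic_ext (Suc m) (Suc n) \<psi>"
  proof (rule periodic_maps_eqI[OF periodic_maps_comp[OF f split_rot_in_periodic_maps]
        periodic_maps_comp[OF split_rot_in_periodic_maps periodic_ext_in_periodic_maps[OF \<psi>]]])
    fix y assume y: "0 \<le> y" "y \<le> int (Suc m)"
    then have "periodic_ext (Suc m) (Suc n) \<psi> (int (nat y)) = int (\<psi> (nat y))"
      by (intro periodic_ext_of_nat) auto
    then have "periodic_ext (Suc m) (Suc n) \<psi> y = f (int i + y) - int j"
      using \<psi>_val[of "nat y"] y by simp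
    moreover have "0 \<le> f (int i + y) - int j" "f (int i + y) - int j \<le> int (Suc n)"
      using bounds[of "nat y"] y by (simp_all add: nat_le_iff)
    ultimately show "(f \<circ> split_rot m i) y = (split_rot n j \<circ> periodic_ext (Suc m) (Suc n) \<psi>) y"
      using y by (simp add: split_rot_apply add.commute)
  qed
  define x' where "x' = act S (Suc n) n x (shift_class n (split_rot n j))"
  have x': "x' \<in> obj S (Suc n)"
    unfolding x'_def by (rule act_in_obj[OF S x split_rot_in_periodic_maps])
  have acts: "act S (Suc m) m (act S m n x (Delta_to_Lam m n \<phi>)) (shift_class m (split_rot m i))
      = act S (Suc m) (Suc n) x' (Delta_to_Lam (Suc m) (Suc n) \<psi>)"
    unfolding x'_def Delta_to_Lam_def f_def[symmetric]
      act_comp[OF S x f split_rot_in_periodic_maps] maps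
      act_comp[OF S x split_rot_in_periodic_maps periodic_ext_in_periodic_maps[OF \<psi>]] by (rule refl)
  have "cls S (Suc m) (act S (Suc m) (Suc n) x' (Delta_to_Lam (Suc m) (Suc n) \<psi>)) (split_tuple m i h g)
      = cls S (Suc n) x' (split_tuple n j h g')"
  proof (rule cls_eqI[OF Delta_closed_cyclic[OF S] \<psi> x' split_tuple_in_F[OF g hc i(1,2) hi]
        split_tuple_in_F[OF g' hc j(1,2) hj]])
    fix l c assume l: "0 < l" "l \<le> Suc n" and c: "c \<le> Suc (Suc m)"
      and cut: "\<And>k. k \<le> Suc m \<Longrightarrow> \<psi> k < l \<longleftrightarrow> k < c"
    \<comment> \<open>Cuts of \<psi> are cuts of the periodic extension, renumbered. Since 0 < l
      \<le> n + 1, the cut lies after i and not beyond i + m + 1.\<close>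
    obtain e where e: "\<And>y. periodic_ext m n \<phi> y < int j + int l \<longleftrightarrow> y < e"
      using periodic_ext_cut_exists[OF \<phi>] by blast
    have lo: "int i < e" using e[of "int i"] f_i l by (simp add: f_def)
    have up: "\<not> int i + int (Suc m) < e"
      using e[of "int i + int (Suc m)"] f_end l by (simp only: f_def) linarith
    have "nat (e - int i) = c"
    proof (rule cut_unique[OF _ c])
      show "nat (e - int i) \<le> Suc (Suc m)" using up by linarith
      fix k assume k: "k \<le> Suc m"
      have "\<psi> k < l \<longleftrightarrow> f (int i + int k) < int j + int l"
        using \<psi>_val[OF k] by linarith
      then show "k < nat (e - int i) \<longleftrightarrow> k < c"
        using e[of "int i + int k"] cut[OF k] lo by (simp only: f_def) linarith
    qed
    then have ec: "e = int i + int c" using lo by linarith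
    have "0 < c" "c \<le> Suc m" using lo up ec by linarith+
    then show "B (split_tuple n j h g') l = B (split_tuple m i h g) c"
      using F_Delta_bt[OF \<phi> g e, folded g'_def] l
      by (simp add: split_tuple_pp[OF g' hc j(1,2) hj] split_tuple_pp[OF g hc i(1,2) hi] ec)
  qed
  then show ?thesis
    using position_eqI[OF g hc i] position_eqI[OF g' hc j]
    by (simp add: shift_pre_def acts x'_def g'_def)
qed

text \<open>Removing the unit in front gives a shorter tuple. Inserting it again at the front or at
  the end are two faces, which differ by a translation by 1, so both tuples are glued to the same
  pair.\<close>

lemma rotate_unit:
  assumes S: "cyclic_set S" and y: "y \<in> obj S n" and g: "g \<in> F n" and one: "B g 1 = \<one>"
  shows "cls S n (act S n n y (rot n 1)) (rotate 1 g) = cls S n y g"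
proof (cases n)
  \<comment> \<open>The only entry is then \<open>z\<close>, which is not the unit.\<close>
  case 0
  then show ?thesis using F_pp_end[OF g] one z_neq_one by simp
next
  case (Suc m)
  define w where "w = tuple m (\<lambda>l. B g (Suc l))"
  have b: "B g (Suc 0) = \<one>" "B g (Suc (Suc m)) = z"
    using one F_pp_end[OF g] Suc by simp_all
  have w: "w \<in> F m"
    unfolding w_def using b pp_mono[OF g] Suc g by (intro tuple_in_F) auto
  have ppw: "B w l = B g (Suc l)" if "l \<le> Suc m" for l
    unfolding w_def using that b g by (intro tuple_pp[where b = "\<lambda>l. B g (Suc l)"]) auto
  define \<phi> where "\<phi> = restrict Suc {..m}"
  define \<psi> where "\<psi> = restrict (\<lambda>k. k) {..m}"
  have \<phi>: "\<phi> \<in> Delta_hom m n" and \<psi>: "\<psi> \<in> Delta_hom m n"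
    unfolding \<phi>_def \<psi>_def using Suc by (auto intro: Delta_homI)
  note per\<phi> = periodic_ext_in_periodic_maps[OF \<phi>] and per\<psi> = periodic_ext_in_periodic_maps[OF \<psi>]
  have maps: "(\<lambda>x. x + 1) \<circ> periodic_ext m n \<psi> = periodic_ext m n \<phi>"
  proof (rule periodic_maps_eqI[OF periodic_maps_comp[OF periodic_maps_add per\<psi>] per\<phi>])
    fix x assume "0 \<le> x" "x \<le> int m"
    then show "((\<lambda>x. x + 1) \<circ> periodic_ext m n \<psi>) x = periodic_ext m n \<phi> x"
      using periodic_ext_of_nat[of "nat x" m n \<phi>] periodic_ext_of_nat[of "nat x" m n \<psi>]
      by (simp add: \<phi>_def \<psi>_def nat_le_iff)
  qed
  have "cls S m (act S m n y (Delta_to_Lam m n \<phi>)) w = cls S n y g"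
  proof (rule cls_eqI[OF Delta_closed_cyclic[OF S] \<phi> y w g])
    fix l c assume l: "0 < l" "l \<le> n" and c: "c \<le> Suc m" "\<And>k. k \<le> m \<Longrightarrow> \<phi> k < l \<longleftrightarrow> k < c"
    have "c = l - 1"
    proof (rule cut_unique[OF c(1)])
      show "k < c \<longleftrightarrow> k < l - 1" if "k \<le> m" for k
        using c(2)[OF that] that by (simp add: \<phi>_def) linarith
    qed (use l Suc in simp)
    then show "B g l = B w c" using ppw[of c] l c(1) by simp
  qed
  moreover have "cls S m (act S m n (act S n n y (rot n 1)) (Delta_to_Lam m n \<psi>)) w
      = cls S n (act S n n y (rot n 1)) (rotate 1 g)"
  proof (rule cls_eqI[OF Delta_closed_cyclic[OF S] \<psi> act_rot_in_obj[OF S y] w rotate_in_F[OF g]])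
    fix l c assume l: "0 < l" "l \<le> n" and c: "c \<le> Suc m" "\<And>k. k \<le> m \<Longrightarrow> \<psi> k < l \<longleftrightarrow> k < c"
    have "c = l"
      using c l Suc by (intro cut_unique[of c m]) (auto simp: \<psi>_def)
    moreover have "bt g 1 = \<one>" "bt g (1 + int l) = B g (Suc l)"
      using bt_of_nat[OF g, of 1] bt_of_nat[OF g, of "Suc l"] one l by simp_all
    ultimately show "B (rotate 1 g) l = B w c"
      using rotate_pp[OF g, of l 1] ppw[of l] g l c(1) by simp
  qed
  moreover have "act S m n (act S n n y (rot n 1)) (Delta_to_Lam m n \<psi>) = act S m n y (Delta_to_Lam m n \<phi>)"
    unfolding rot_def Delta_to_Lam_def act_comp[OF S y periodic_maps_add per\<psi>] maps by (rule refl)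
  ultimately show ?thesis by simp
qed

text \<open>Equal vertices at \<open>a\<close> and \<open>b\<close> force all vertices between them
  to coincide, so the entries in between are units and can be rotated away one by one.\<close>

lemma rotate_units:
  assumes S: "cyclic_set S" and x: "x \<in> obj S n" and g: "g \<in> F n"
    and "a \<le> b" "bt g (int a) = bt g (int b)"
  shows "cls S n (act S n n x (rot n (int a))) (rotate a g) = cls S n (act S n n x (rot n (int b))) (rotate b g)"
  using assms(4,5)
proof (induction b rule: dec_induct)
  case (step b)
  have "bt g (int a) \<sqsubseteq> bt g (int b)" "bt g (int b) \<sqsubseteq> bt g (int (Suc b))"
    using step.hyps by (simp_all add: bt_mono[OF g])
  then have eq: "bt g (int b) = bt g (int a)"
    using step.prems g by (intro le_antisym) auto
  have "B (rotate b g) 1 = \<one>"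
    using rotate_pp[OF g, of 1 b] eq step.prems g by (simp add: add.commute)
  from rotate_unit[OF S act_rot_in_obj[OF S x] rotate_in_F[OF g] this]
  have "cls S n (act S n n x (rot n (int b + 1))) (rotate (Suc b) g)
      = cls S n (act S n n x (rot n (int b))) (rotate b g)"
    by (simp add: act_rot_rot[OF S x])
  then show ?case
    using step.IH[OF eq[symmetric]] by (simp add: add.commute)
qed simp

text \<open>Splitting at an existing vertex yields the rotated tuple with a unit appended, and the
  face omitting the last index removes it.\<close>

lemma shift_pre_at_vertex:
  assumes S: "cyclic_set S" and x: "x \<in> obj S n" and g: "g \<in> F n"
    and i: "i \<le> n" "\<not> B g (Suc i) \<sqsubseteq> B g i"
  shows "shift_pre S (B g i) (n, x, g) = cls S n (act S n n x (rot n (int i))) (rotate i g)"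
proof -
  define h where "h = B g i"
  have h: "h \<in> carrier G" "B g i \<sqsubseteq> h" "h \<sqsubseteq> B g (Suc i)" "\<not> B g (Suc i) \<sqsubseteq> h"
    using g i pp_mono[OF g, of i "Suc i"] by (auto simp: h_def)
  define \<phi> where "\<phi> = restrict (\<lambda>k. k) {..n}"
  have \<phi>: "\<phi> \<in> Delta_hom n (Suc n)"
    unfolding \<phi>_def by (rule Delta_homI) auto
  note per = periodic_ext_in_periodic_maps[OF \<phi>]
  have maps: "split_rot n i \<circ> periodic_ext n (Suc n) \<phi> = (\<lambda>x. x + int i)"
  proof (rule periodic_maps_eqI[OF periodic_maps_comp[OF split_rot_in_periodic_maps per] periodic_maps_add])
    fix y assume y: "0 \<le> y" "y \<le> int n"
    then have "periodic_ext n (Suc n) \<phi> y = y"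
      using periodic_ext_of_nat[of "nat y" n "Suc n" \<phi>] by (simp add: \<phi>_def nat_le_iff)
    then show "(split_rot n i \<circ> periodic_ext n (Suc n) \<phi>) y = y + int i"
      using y by (simp add: split_rot_apply)
  qed
  define x' where "x' = act S (Suc n) n x (shift_class n (split_rot n i))"
  have x': "x' \<in> obj S (Suc n)"
    unfolding x'_def by (rule act_in_obj[OF S x split_rot_in_periodic_maps])
  have "cls S n (act S n (Suc n) x' (Delta_to_Lam n (Suc n) \<phi>)) (rotate i g)
      = cls S (Suc n) x' (split_tuple n i h g)"
  proof (rule cls_eqI[OF Delta_closed_cyclic[OF S] \<phi> x' rotate_in_F[OF g]
        split_tuple_in_F[OF g h(1) i(1) h(2,3)]])
    fix l c assume l: "0 < l" "l \<le> Suc n" and c: "c \<le> Suc n" "\<And>k. k \<le> n \<Longrightarrow> \<phi> k < l \<longleftrightarrow> k < c"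
    have "c = l"
      using c l by (intro cut_unique[of c n]) (auto simp: \<phi>_def)
    then show "B (split_tuple n i h g) l = B (rotate i g) c"
      using l i bt_of_nat[OF g, of i]
      by (simp add: split_tuple_pp[OF g h(1) i(1) h(2,3)] rotate_pp[OF g]) (simp add: h_def)
  qed
  moreover have "act S n (Suc n) x' (Delta_to_Lam n (Suc n) \<phi>) = act S n n x (rot n (int i))"
    unfolding x'_def Delta_to_Lam_def act_comp[OF S x split_rot_in_periodic_maps per] maps rot_def
    by (rule refl)
  ultimately show ?thesis
    using position_eqI[OF g h(1) i(1) h(2,4)] by (simp add: shift_pre_def x'_def h_def)
qed

text \<open>\<open>position\<close> finds the last vertex equal to \<open>h\<close> whereas
  \<open>a\<close> may be an earlier one; the two are linked by rotating units. The coset may also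
  match because vertex \<open>a\<close> is \<open>z\<close> while \<open>h\<close> is the
  unit.\<close>

lemma shift_pre_eq:
  assumes S: "cyclic_set S" and x: "x \<in> obj S n" and g: "g \<in> F n"
    and h: "h \<in> P" "h \<sqsubseteq> z" "h \<noteq> z" and a: "a \<le> n" and coset: "coset (B g a) = coset h"
  shows "shift_pre S h (n, x, g) = cls S n (act S n n x (rot n (int a))) (rotate a g)"
proof -
  have interior: "shift_pre S h (n, x, g) = cls S n (act S n n x (rot n (int a))) (rotate a g)"
    if a: "a \<le> n" and ha: "B g a = h" for a
  proof -
    obtain i where i: "i \<le> n" "B g i \<sqsubseteq> h" "\<not> B g (Suc i) \<sqsubseteq> h"
      using position_exists[OF g h] .
    have "\<not> i < a"
      using pp_mono[OF g, of "Suc i" a] a i(3) ha by auto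
    then have "a \<le> i" by simp
    then have "B g a \<sqsubseteq> B g i" using i(1) by (intro pp_mono[OF g]) auto
    then have hi: "B g i = h" using i(2) h(1) g ha by (intro le_antisym) auto
    have "bt g (int a) = bt g (int i)"
      using a i(1) ha hi by (simp add: bt_of_nat[OF g])
    then show ?thesis
      using rotate_units[OF S x g \<open>a \<le> i\<close>] shift_pre_at_vertex[OF S x g i(1)] i(3) by (simp add: hi)
  qed
  have "B g a = h \<or> B g a = z \<and> h = \<one>"
    using coset_eq_in_interval[OF pp_pos[OF g, of a] h(1) pp_le_z[OF g, of a] h(2) coset] a h(3) by auto
  then show ?thesis
  proof
    assume "B g a = h" then show ?thesis by (rule interior[OF a])
  next
    assume z: "B g a = z \<and> h = \<one>"
    \<comment> \<open>All entries from \<open>a\<close> on are units, so the rotation can be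
      completed to a full turn, which acts trivially.\<close>
    have "bt g (int a) = bt g (int (Suc n))"
      using z a by (simp only: bt_of_nat[OF g] F_pp_end[OF g] le_SucI order_refl)
    then have "cls S n (act S n n x (rot n (int a))) (rotate a g)
        = cls S n (act S n n x (rot n (int (Suc n)))) (rotate (Suc n) g)"
      using a by (intro rotate_units[OF S x g]) auto
    also have "\<dots> = cls S n x g"
      using F_length[OF g] rotate_id[of "Suc n" g] by (simp only: rot_period act_Lam_id[OF S x]) simp
    also have "\<dots> = shift_pre S h (n, x, g)"
      using interior[of 0] z act_Lam_id[OF S x] by (simp add: Lam_id_rot)
    finally show ?thesis by simp
  qed
qed

text \<open>The choice is the representative of the coset in the half-open interval, the range in
  which \<open>shift_pre\<close> is shown to respect gluing.\<close>

definition action :: "'s cyclic \<Rightarrow> ('s, 'g) pre_point set \<Rightarrow> ((int \<Rightarrow> int) set, 'g) pre_point set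
    \<Rightarrow> ('s, 'g) pre_point set" where
  "action S = (\<lambda>X\<in>real S. \<lambda>c\<in>real C_cyc.
     the_elem (shift_pre S (SOME h. h \<in> P \<and> h \<sqsubseteq> z \<and> h \<noteq> z \<and> coset h = iota c) ` X))"

lemma action_rot:
  assumes S: "cyclic_set S" and x: "x \<in> obj S n" and g: "g \<in> F n"
  shows "action S (cls S n x g) (cls C_cyc n (rot n (- int a)) g)
    = cls S n (act S n n x (rot n (int a))) (rotate a g)"
proof -
  obtain b where b: "b \<le> n" "rot n (- int a) = rot n (- int b)"
    using Lam_aut_cases[OF rot_in_Lam_aut] by metis
  \<comment> \<open>The exponent \<open>a\<close> is arbitrary. Applying inversion and
    \<open>F\<close> to the equality of classes transfers both sides to the reduced
    exponent.\<close>
  have "rot n (int a) = rot n (int b)" "rotate a g = rotate b g"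
    using arg_cong[OF b(2), of "Lam_inv n"] arg_cong[OF b(2), of "\<lambda>\<gamma>. F_Lam G n n \<gamma> g"]
    by (simp_all add: Lam_inv_rot F_Lam_rot[OF g])
  moreover have "action S (cls S n x g) (cls C_cyc n (rot n (- int b)) g)
    = cls S n (act S n n x (rot n (int b))) (rotate b g)"
  proof -
    define c where "c = cls C_cyc n (rot n (- int b)) g"
    have c: "c \<in> real C_cyc" unfolding c_def by (rule cls_rot_in_real[OF g])
    then obtain k where k: "k \<in> P" "k \<sqsubseteq> z" "k \<noteq> z" "c = D k"
      by (rule real_C_D)
    define h where "h = (SOME h. h \<in> P \<and> h \<sqsubseteq> z \<and> h \<noteq> z \<and> coset h = iota c)"
    have h: "h \<in> P \<and> h \<sqsubseteq> z \<and> h \<noteq> z \<and> coset h = iota c"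
      unfolding h_def by (rule someI[of _ k]) (use k iota_D in auto)
    have "action S (cls S n x g) c = the_elem (shift_pre S h ` cls S n x g)"
      using c cls_in_real[OF x g] by (simp add: action_def h_def)
    also have "\<dots> = shift_pre S h (n, x, g)"
      using h by (intro lift_cls[OF Delta_closed_cyclic[OF S] x g] shift_pre_glue[OF S]) auto
    also have "\<dots> = cls S n (act S n n x (rot n (int b))) (rotate b g)"
      using h b(1) iota_cls[OF g, of "int b"]
      by (intro shift_pre_eq[OF S x g]) (auto simp: c_def bt_of_nat[OF g])
    finally show ?thesis by (simp add: c_def)
  qed
  ultimately show ?thesis by (simp add: b(2))
qed

lemma action_right_group_action:
  assumes M: "C_group_law G P z M" and S: "cyclic_set S"
  shows "right_group_action M (real S) (action S)"
  unfolding right_group_action_def C_group_law_carrier[OF M]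
proof (intro conjI ballI)
  note Sd = Delta_closed_cyclic[OF S]
  have closed: "action S X c \<in> real S" if X: "X \<in> real S" and c: "c \<in> real C_cyc" for X c
  proof -
    obtain n x g a b where x: "x \<in> obj S n" and g: "g \<in> F n" and e: "X = cls S n x g"
      "c = cls C_cyc n (rot n (- int a)) g" "c = cls C_cyc n (rot n (- int b)) (rotate a g)"
      using common_representatives[OF Sd X c c] .
    show ?thesis
      unfolding e(1,2) action_rot[OF S x g] by (rule cls_in_real[OF act_rot_in_obj[OF S x] rotate_in_F[OF g]])
  qed
  show "action S \<in> real S \<rightarrow>\<^sub>E real C_cyc \<rightarrow>\<^sub>E real S"
  proof (rule PiE_I)
    fix X assume X: "X \<in> real S"
    show "action S X \<in> real C_cyc \<rightarrow>\<^sub>E real S"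
      by (rule PiE_I) (use closed[OF X] X in \<open>simp_all add: action_def\<close>)
  qed (simp add: action_def)
  fix X assume X: "X \<in> real S"
  show "action S X \<one>\<^bsub>M\<^esub> = X"
  proof -
    interpret M: group M using M by (simp add: C_group_law_def)
    obtain n x g where x: "x \<in> obj S n" and g: "g \<in> F n" and e: "X = cls S n x g"
      using X by (rule real_cases)
    \<comment> \<open>On every tuple the unit is marked by vertex 0, so it can be put on the tuple
      of \<open>X\<close>.\<close>
    have "\<one>\<^bsub>M\<^esub> = cls C_cyc n (rot n (- int 0)) g"
    proof (rule iota_inj)
      show "\<one>\<^bsub>M\<^esub> \<in> real C_cyc" using M.one_closed by (simp only: C_group_law_carrier[OF M])
      have "coset \<one> = \<one>\<^bsub>Q\<^esub>"
        using coset_mult_one by (simp add: FactGroup_def int_powers_def image_subset_iff)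
      then show "iota \<one>\<^bsub>M\<^esub> = iota (cls C_cyc n (rot n (- int 0)) g)"
        unfolding C_group_law_one[OF M] iota_cls[OF g] by (simp only: of_nat_0 bt_0[OF g])
    qed (rule cls_rot_in_real[OF g])
    then show ?thesis
      using action_rot[OF S x g, of 0] act_Lam_id[OF S x] by (simp add: e Lam_id_rot)
  qed
  fix c d assume c: "c \<in> real C_cyc" and d: "d \<in> real C_cyc"
  \<comment> \<open>With all three points on one tuple, compatibility with products is the addition
    of rotation exponents.\<close>
  obtain n x g a b where x: "x \<in> obj S n" and g: "g \<in> F n" and e: "X = cls S n x g"
    "c = cls C_cyc n (rot n (- int a)) g" "d = cls C_cyc n (rot n (- int b)) (rotate a g)"
    using common_representatives[OF Sd X c d] .
  have cd: "c \<otimes>\<^bsub>M\<^esub> d = cls C_cyc n (rot n (- int (a + b))) g"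
    unfolding e C_group_law_rot[OF M g] rot_comp by simp
  have "action S (action S X c) d
      = cls S n (act S n n x (rot n (int a + int b))) (rotate b (rotate a g))"
    unfolding e action_rot[OF S x g] action_rot[OF S act_rot_in_obj[OF S x] rotate_in_F[OF g]]
      act_rot_rot[OF S x] by (rule refl)
  also have "\<dots> = action S X (c \<otimes>\<^bsub>M\<^esub> d)"
    unfolding cd e(1) action_rot[OF S x g] by (simp add: rotate_rotate add.commute)
  finally show "action S (action S X c) d = action S X (c \<otimes>\<^bsub>M\<^esub> d)" .
qed

lemma action_unique:
  assumes M: "C_group_law G P z M" and S: "cyclic_set S"
    and A: "right_group_action M (real S) A"
    and eq: "\<forall>n. \<forall>\<gamma> \<in> Lam_aut n. \<forall>x \<in> obj S n. \<forall>g \<in> F n.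
      A (cls S n x g) (cls C_cyc n \<gamma> g) = cls S n (act S n n x (Lam_inv n \<gamma>)) (F_Lam G n n \<gamma> g)"
  shows "A = action S"
proof -
  have ext: "A \<in> real S \<rightarrow>\<^sub>E real C_cyc \<rightarrow>\<^sub>E real S" "action S \<in> real S \<rightarrow>\<^sub>E real C_cyc \<rightarrow>\<^sub>E real S"
    using A action_right_group_action[OF M S]
    by (simp_all only: right_group_action_def C_group_law_carrier[OF M])
  show ?thesis
  proof (rule PiE_ext[OF ext])
    fix X assume X: "X \<in> real S"
    show "A X = action S X"
    proof (rule PiE_ext[OF PiE_mem[OF ext(1) X] PiE_mem[OF ext(2) X]])
      fix c assume c: "c \<in> real C_cyc"
      \<comment> \<open>Refinement puts \<open>X\<close> and \<open>c\<close> on a common tuple,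
        where the prescribed formula fixes the value.\<close>
      obtain n x g a b where x: "x \<in> obj S n" and g: "g \<in> F n" and e: "X = cls S n x g"
        "c = cls C_cyc n (rot n (- int a)) g" "c = cls C_cyc n (rot n (- int b)) (rotate a g)"
        using common_representatives[OF Delta_closed_cyclic[OF S] X c c] .
      show "A X c = action S X c"
        unfolding e(1,2) action_rot[OF S x g]
        using eq x g rot_in_Lam_aut[of n "- int a"] by (simp add: Lam_inv_rot F_Lam_rot)
    qed
  qed
qed

end

theorem theorem4p4:
  fixes G :: "('g, 'b) monoid_scheme" and P :: "'g set" and z :: 'g
  assumes "left_ordered_group G P"
    and "z \<in> P"
    and "\<forall>g \<in> carrier G. z \<otimes>\<^bsub>G\<^esub> g = g \<otimes>\<^bsub>G\<^esub> z"
    and "lo_le G P \<one>\<^bsub>G\<^esub> z" and "z \<noteq> \<one>\<^bsub>G\<^esub>"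
  shows "(\<exists>!M. C_group_law G P z M) \<and>
    (\<forall>M. C_group_law G P z M \<longrightarrow>
      (\<exists>!\<iota>. is_iota G P z \<iota>) \<and>
      (\<forall>\<iota>. is_iota G P z \<iota> \<longrightarrow>
         \<iota> \<in> iso M (G\<lparr>carrier := bounded_part G P z\<rparr> Mod int_powers G z))) \<and>
    (\<forall>M (S :: 's cyclic). C_group_law G P z M \<longrightarrow> cyclic_set S \<longrightarrow>
      (\<exists>!A. right_group_action M (cyc_realization G P z S) A \<and>
         (\<forall>n. \<forall>\<gamma> \<in> Lam_aut n. \<forall>x \<in> obj S n. \<forall>g \<in> F_obj G P z n.
            A (cyc_class G P z S n x g) (cyc_class G P z C_cyc n \<gamma> g)
              = cyc_class G P z S n (act S n n x (Lam_inv n \<gamma>)) (F_Lam G n n \<gamma> g))))"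
proof -
  interpret central_interval G P z
    using assms by (intro central_interval.intro central_interval_axioms.intro) auto
  show ?thesis
  proof (intro conjI allI impI)
    show "\<exists>!M. C_group_law G P z M"
      using C_group_law_C_group C_group_law_unique by blast
  next
    show "\<exists>!\<iota>. is_iota G P z \<iota>"
      by (simp add: is_iota_iff)
  next
    fix M \<iota> assume "C_group_law G P z M" "is_iota G P z \<iota>"
    then show "\<iota> \<in> iso M (G\<lparr>carrier := bounded_part G P z\<rparr> Mod int_powers G z)"
      using iota_iso by (simp only: is_iota_iff)
  next
    fix M and S :: "'s cyclic"
    assume M: "C_group_law G P z M" and S: "cyclic_set S"
    show "\<exists>!A. right_group_action M (cyc_realization G P z S) A \<and>
         (\<forall>n. \<forall>\<gamma> \<in> Lam_aut n. \<forall>x \<in> obj S n. \<forall>g \<in> F_obj G P z n.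
            A (cyc_class G P z S n x g) (cyc_class G P z C_cyc n \<gamma> g)
              = cyc_class G P z S n (act S n n x (Lam_inv n \<gamma>)) (F_Lam G n n \<gamma> g))"
    proof (rule ex1I[of _ "action S"])
      show "right_group_action M (cyc_realization G P z S) (action S) \<and>
         (\<forall>n. \<forall>\<gamma> \<in> Lam_aut n. \<forall>x \<in> obj S n. \<forall>g \<in> F_obj G P z n.
            action S (cyc_class G P z S n x g) (cyc_class G P z C_cyc n \<gamma> g)
              = cyc_class G P z S n (act S n n x (Lam_inv n \<gamma>)) (F_Lam G n n \<gamma> g))"
        using action_right_group_action[OF M S]
        by (auto elim!: Lam_aut_cases simp: action_rot[OF S] Lam_inv_rot F_Lam_rot)
    qed (use action_unique[OF M S] in blast)
  qed
qed

end
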